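(* Let $R_0>0$, let $D \subset \mathbf{R}^2$ be the (open) disk of radius $R_0$ centered at the origin, let $S := \partial D$ denote the boundary circle, and let $f \in C^{\infty}(\mathbf{R}^2)$ with $\operatorname{supp} f \subset \overline{D}$. For $p\in S$ let $(\mathcal{M} f)(p,\cdot)$ be extended to negative $r$ as an odd function, $(\mathcal{M} f)(p,-r) := -(\mathcal{M} f)(p,r)$. Then, for every $x \in D$, $$f(x) = \frac{1}{2\pi R_0} \int_S \int_{-2R_0}^{2R_0} \frac{r\,(\partial_r \mathcal{M} f)(p,r)}{|x-p|-r}\, dr\, ds(p)$$ and $$f(x) = \frac{1}{2\pi R_0} \int_S |x-p| \int_{-2R_0}^{2R_0} \frac{(\partial_r \mathcal{M} f)(p,r)}{|x-p|-r}\, dr\, ds(p),$$ where the inner integrals are taken in the principal value sense.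
   Context: For $f\in C^\infty(\mathbf{R}^2)$, the circular mean transform is $(\mathcal{M} f)(x,r) = \frac{1}{2\pi}\int_{S^1} f(x+r\theta)\, ds(\theta)$ for $(x,r)\in\mathbf{R}^2\times[0,\infty)$, where $S^1$ is the unit circle and $ds$ denotes arc length measure (on $S^1$ and on $S$). $\partial_r$ is the partial derivative with respect to the second variable of $\mathcal{M} f$ (after the odd extension). The principal value is with respect to the singularity at $r=|x-p|$. *)

theory Defs
  imports "HOL-Analysis.Analysis"
begin

primrec C_k :: "nat \<Rightarrow> ('a::euclidean_space \<Rightarrow> real) \<Rightarrow> bool" where
  "C_k 0 f \<longleftrightarrow> continuous_on UNIV f"
| "C_k (Suc k) f \<longleftrightarrow>
     (\<forall>x. f differentiable (at x)) \<and> (\<forall>v. C_k k (\<lambda>x. frechet_derivative f (at x) v))"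

definition C_infinity :: "('a::euclidean_space \<Rightarrow> real) \<Rightarrow> bool" where
  "C_infinity f \<longleftrightarrow> (\<forall>k. C_k k f)"

definition support :: "('a::topological_space \<Rightarrow> real) \<Rightarrow> 'a set" where
  "support f = closure {x. f x \<noteq> 0}"

(* Push-forward of Lebesgue measure under the unit-speed parametrisation of the circle;
   the underlying space is the circle itself. Meaningful for R > 0. *)
definition arc_length_measure :: "real \<Rightarrow> (real^2) measure" where
  "arc_length_measure R =
     distr (restrict_space lborel {0..<2 * pi * R}) (restrict_space borel (sphere 0 R))
       (\<lambda>s. vector [R * cos (s / R), R * sin (s / R)])"

definition circular_mean :: "(real^2 \<Rightarrow> real) \<Rightarrow> real^2 \<Rightarrow> real \<Rightarrow> real" where
  "circular_mean f x r = 1 / (2 * pi) * (\<integral>\<theta>. f (x + r *\<^sub>R \<theta>) \<partial>(arc_length_measure 1))"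

definition odd_extension :: "(real \<Rightarrow> real) \<Rightarrow> real \<Rightarrow> real" where
  "odd_extension g r = (if 0 \<le> r then g r else - g (- r))"

definition dr_circular_mean :: "(real^2 \<Rightarrow> real) \<Rightarrow> real^2 \<Rightarrow> real \<Rightarrow> real" where
  "dr_circular_mean f p r = deriv (odd_extension (circular_mean f p)) r"

(* Principal values of integrals over [a, b] with respect to a singularity at c:
   the symmetric neighbourhood of radius e about c is cut out, and e tends to 0. *)
definition pv_truncation :: "real \<Rightarrow> real \<Rightarrow> real \<Rightarrow> (real \<Rightarrow> real) \<Rightarrow> real \<Rightarrow> real" where
  "pv_truncation a b c g e = (LBINT r:{a..b} - {c - e<..<c + e}. g r)"

definition pv_integrable :: "real \<Rightarrow> real \<Rightarrow> real \<Rightarrow> (real \<Rightarrow> real) \<Rightarrow> bool" where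
  "pv_integrable a b c g \<longleftrightarrow>
     (\<forall>e>0. set_integrable lborel ({a..b} - {c - e<..<c + e}) g) \<and>
     (\<exists>L. (pv_truncation a b c g \<longlongrightarrow> L) (at_right 0))"

definition pv_integral :: "real \<Rightarrow> real \<Rightarrow> real \<Rightarrow> (real \<Rightarrow> real) \<Rightarrow> real" where
  "pv_integral a b c g = Lim (at_right 0) (pv_truncation a b c g)"

end

theory Submission
  imports Defs "HOL-Real_Asymp.Real_Asymp" "HOL-Library.Periodic_Fun"
begin

text \<open>
  Write \<open>M(p, r)\<close> for the mean of \<open>f\<close> and \<open>L(p, r)\<close> for the mean of \<open>\<Delta>f\<close> over the circle with
  centre \<open>p\<close> and radius \<open>r\<close>, let \<open>c = |x - p|\<close>, and let \<open>R\<close> be the radius of the disk. The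
  Darboux equation \<open>\<partial>\<^sub>r (r \<partial>\<^sub>r M) = r L\<close> (\<open>darboux_equation\<close>) and one integration by parts remove the
  singularity. There are no boundary terms because \<open>r \<partial>\<^sub>r M\<close> vanishes at \<open>-2R\<close> and \<open>2R\<close>; after folding
  \<open>[-2R, 2R]\<close> onto \<open>[0, 2R]\<close>, the principal value with the kernel \<open>r / (c - r)\<close> is the absolutely
  convergent integral of \<open>r L(p, r) ln |r\<^sup>2 - c\<^sup>2|\<close> over \<open>[0, 2R]\<close>. In polar coordinates
  about \<open>p\<close> this is \<open>1 / (2\<pi>)\<close> times the integral over the plane of
  \<open>\<Delta>f(y) ln | |y - p|\<^sup>2 - |x - p|\<^sup>2 |\<close>.

  This form can be integrated over \<open>p\<close> first. The difference \<open>|y - p|\<^sup>2 - |x - p|\<^sup>2\<close> is affine in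
  \<open>p\<close>: on the circle \<open>p = R (cos t, sin t)\<close> it has the form \<open>a - b cos (t - \<phi>)\<close> with
  \<open>b = 2 R |y - x|\<close>, and \<open>|a| < b\<close> whenever \<open>x\<close> and \<open>y\<close> are distinct points of the open disk. The mean of
  \<open>ln |a - b cos t|\<close> over a period is then \<open>ln (b / 2)\<close> for every such \<open>a\<close>
  (\<open>ln_linear_cos_integral\<close>), which rests on the vanishing of the integral of \<open>ln |2 sin (t / 2)|\<close>.
  Integrating over the circle thus leaves, up to a constant factor, \<open>\<Delta>f(y) (ln R + ln |y - x|)\<close>. As \<open>ln |y - x|\<close> is \<open>2\<pi>\<close> times the
  fundamental solution of the Laplacian, its integral against \<open>\<Delta>f\<close> is \<open>2\<pi> f(x)\<close>, while the constant
  \<open>ln R\<close> contributes nothing; this is the Darboux equation once more, now for circles centred at \<open>x\<close>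
  (\<open>potential_recovers_f\<close>).

  For the second formula, \<open>c / (c - r) = 1 + r / (c - r)\<close>. The two inner integrals therefore differ by
  the integral of \<open>\<partial>\<^sub>r M\<close> over \<open>[-2R, 2R]\<close>, which is \<open>2 (M(p, 2R) - M(p, 0)) = 0\<close>: the function \<open>f\<close>
  vanishes at \<open>p\<close> and on the circle of radius \<open>2R\<close> about \<open>p\<close>.
\<close>

section \<open>Logarithmic integrals\<close>

lemma isCont_times_ln_abs: "isCont (\<lambda>u::real. u * ln \<bar>u\<bar>) z"
proof (cases "z = 0")
  case True
  have "((\<lambda>u::real. u * ln \<bar>u\<bar>) \<longlongrightarrow> 0) (at_left 0)" "((\<lambda>u::real. u * ln \<bar>u\<bar>) \<longlongrightarrow> 0) (at_right 0)"
    by real_asymp+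
  then have "((\<lambda>u::real. u * ln \<bar>u\<bar>) \<longlongrightarrow> 0) (at 0)"
    by (simp add: filterlim_split_at)
  then show ?thesis
    using True by (simp add: isCont_def)
next
  case False
  then show ?thesis
    by (intro continuous_intros) auto
qed

lemma DERIV_ln_abs:
  fixes u :: real
  assumes "u \<noteq> 0"
  shows "((\<lambda>u. ln \<bar>u\<bar>) has_real_derivative 1 / u) (at u)"
proof (cases "u > 0")
  case True
  have "((\<lambda>u. ln u) has_real_derivative 1 / u) (at u)"
    using True by (rule DERIV_ln_divide)
  then show ?thesis
    by (rule has_field_derivative_transform_within_open[where S="{0<..}"]) (use True in auto)
next
  case False
  then have "u < 0" using assms by simp
  have "((\<lambda>u. ln (-u)) has_real_derivative 1 / u) (at u)"
    using \<open>u < 0\<close> by (auto intro!: derivative_eq_intros simp: field_simps)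
  then show ?thesis
    by (rule has_field_derivative_transform_within_open[where S="{..<0}"]) (use \<open>u < 0\<close> in auto)
qed

lemma DERIV_times_ln_abs:
  fixes u :: real
  assumes "u \<noteq> 0"
  shows "((\<lambda>u. u * ln \<bar>u\<bar>) has_real_derivative ln \<bar>u\<bar> + 1) (at u)"
  using DERIV_mult[OF DERIV_ident DERIV_ln_abs[OF assms]] assms by simp

lemma set_integrable_lborel_if_absolutely_integrable:
  fixes f :: "'a::euclidean_space \<Rightarrow> real"
  assumes "f \<in> borel_measurable borel" "S \<in> sets borel" "f absolutely_integrable_on S"
  shows "set_integrable lborel S f"
  using assms integrable_completion[of "\<lambda>x. indicator S x *\<^sub>R f x" lborel]
  by (auto simp: set_integrable_def)

text \<open>
  The antiderivative \<open>(r - c) ln |r - c| - (r - c)\<close> extends continuously through \<open>c\<close>, so the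
  fundamental theorem of calculus applies across the singularity. Absolute integrability needs a
  constant sign, which a large constant \<open>ln N\<close> provides.
\<close>

lemma set_integrable_ln_abs_diff:
  fixes a b c :: real
  shows "set_integrable lborel {a..b} (\<lambda>r. ln \<bar>r - c\<bar>)"
proof (cases "a \<le> b")
  case True
  \<comment> \<open>\<open>N\<close> bounds \<open>|r - c|\<close> on the interval; the summand \<open>1\<close> gives \<open>ln N \<ge> 0\<close>, needed at \<open>r = c\<close>, where \<open>ln 0 = 0\<close>\<close>
  define N where "N = \<bar>a - c\<bar> + \<bar>b - c\<bar> + 1"
  have "continuous_on {a..b} (\<lambda>r. (r - c) * ln \<bar>r - c\<bar>)"
    by (rule continuous_on_compose2[of UNIV "\<lambda>u. u * ln \<bar>u\<bar>"])
      (auto intro!: continuous_at_imp_continuous_on isCont_times_ln_abs continuous_intros)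
  then have "continuous_on {a..b} (\<lambda>r. (r - c) * (ln N + 1) - (r - c) * ln \<bar>r - c\<bar>)"
    by (rule continuous_on_diff[rotated]) (auto intro!: continuous_intros)
  moreover have "((\<lambda>r. (r - c) * (ln N + 1) - (r - c) * ln \<bar>r - c\<bar>) has_real_derivative
      ln N - ln \<bar>r - c\<bar>) (at r)" if "r \<noteq> c" for r
  proof -
    have "((\<lambda>r. (r - c) * ln \<bar>r - c\<bar>) has_real_derivative (ln \<bar>r - c\<bar> + 1) * 1) (at r)"
      using that by (intro DERIV_chain2[OF DERIV_times_ln_abs, where g="\<lambda>r. r - c"])
        (auto intro!: derivative_eq_intros)
    moreover have "((\<lambda>r. (r - c) * (ln N + 1)) has_real_derivative ln N + 1) (at r)"
      by (auto intro!: derivative_eq_intros)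
    ultimately show ?thesis
      using DERIV_diff by fastforce
  qed
  ultimately have "(\<lambda>r. ln N - ln \<bar>r - c\<bar>) integrable_on {a..b}"
    using fundamental_theorem_of_calculus_interior_strong[where S="{c}" and a=a and b=b and
        f="\<lambda>r. (r - c) * (ln N + 1) - (r - c) * ln \<bar>r - c\<bar>" and f'="\<lambda>r. ln N - ln \<bar>r - c\<bar>"] True
    by (auto simp: has_real_derivative_iff_has_vector_derivative integrable_on_def)
  moreover have "0 \<le> ln N - ln \<bar>r - c\<bar>" if "r \<in> {a..b}" for r
  proof (cases "r = c")
    case True then show ?thesis by (auto simp: N_def)
  next
    case False
    have "\<bar>r - c\<bar> \<le> N" using that by (auto simp: N_def)
    then show ?thesis using False by simp
  qed
  ultimately have "(\<lambda>r. ln N - ln \<bar>r - c\<bar>) absolutely_integrable_on {a..b}"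
    by (intro nonnegative_absolutely_integrable_1) auto
  then have "set_integrable lborel {a..b} (\<lambda>r. ln N - ln \<bar>r - c\<bar>)"
    by (intro set_integrable_lborel_if_absolutely_integrable) auto
  moreover have "set_integrable lborel {a..b} (\<lambda>r. ln N)"
    by (intro borel_integrable_atLeastAtMost') auto
  ultimately show ?thesis
    using set_integral_diff(1)[of lborel "{a..b}" "\<lambda>r. ln N" "\<lambda>r. ln N - ln \<bar>r - c\<bar>"] by simp
qed (simp add: set_integrable_def)

text \<open>
  A lower bound for \<open>sin\<close> that vanishes to first order at both ends of \<open>[0, \<pi>]\<close>. It reduces the
  singularities of \<open>ln |2 sin (t / 2)|\<close> to those of \<open>ln t\<close> and \<open>ln (2\<pi> - t)\<close>.
\<close>

lemma sin_ge_parabola: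
  fixes u :: real
  assumes "0 \<le> u" "u \<le> pi"
  shows "u * (pi - u) / (4 * pi) \<le> sin u"
proof -
  have quarter: "v / 4 \<le> sin v" if "0 \<le> v" "v \<le> pi / 2" for v :: real
  proof -
    have "v \<le> 2" using that pi_less_4 by linarith
    have "v ^ 3 \<le> v * 4"
      using mult_left_mono[OF power_mono[OF \<open>v \<le> 2\<close> that(1), of 2], of v] that
      by (simp add: power2_eq_square power3_eq_cube)
    moreover have "\<bar>sin v - v\<bar> \<le> v ^ 3 / 6"
      using Maclaurin_sin_bound[of v 3] that
      by (simp add: eval_nat_numeral lessThan_Suc sin_coeff_def divide_simps)
    ultimately show ?thesis by linarith
  qed
  have prod: "u * (pi - u) / (4 * pi) = u / 4 * ((pi - u) / pi)" "u * (pi - u) / (4 * pi) = (pi - u) / 4 * (u / pi)"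
    by simp_all
  have le1: "(pi - u) / pi \<le> 1" "u / pi \<le> 1"
    using assms by (simp_all add: divide_le_eq_1)
  show ?thesis
  proof (cases "u \<le> pi / 2")
    case True
    have "u * (pi - u) / (4 * pi) \<le> u / 4"
      unfolding prod(1) using le1 assms by (intro mult_left_le) auto
    also have "\<dots> \<le> sin u" using quarter[of u] True assms by simp
    finally show ?thesis .
  next
    case False
    have "u * (pi - u) / (4 * pi) \<le> (pi - u) / 4"
      unfolding prod(2) using le1 assms by (intro mult_left_le) auto
    also have "\<dots> \<le> sin (pi - u)" using quarter[of "pi - u"] False assms by simp
    finally show ?thesis by simp
  qed
qed

definition ln_sin_half :: "real \<Rightarrow> real" where
  "ln_sin_half t = ln \<bar>2 * sin (t / 2)\<bar>"

lemma borel_measurable_ln_sin_half [measurable]: "ln_sin_half \<in> borel_measurable borel"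
  unfolding ln_sin_half_def by measurable

lemma ln_sin_half_periodic: "ln_sin_half (t + 2 * pi) = ln_sin_half t"
proof -
  have "sin ((t + 2 * pi) / 2) = - sin (t / 2)"
    by (simp add: add_divide_distrib)
  then show ?thesis by (simp add: ln_sin_half_def)
qed

lemma set_integrable_ln_sin_half: "set_integrable lborel {0..2*pi} ln_sin_half"
proof (rule set_integrable_bound)
  let ?g = "\<lambda>t. ln 2 + \<bar>ln \<bar>t - 0\<bar>\<bar> + \<bar>ln \<bar>t - 2 * pi\<bar>\<bar> + \<bar>ln (8 * pi)\<bar>"
  have const: "set_integrable lborel {0..2*pi} (\<lambda>_. c)" for c :: real
    by (intro borel_integrable_atLeastAtMost') auto
  show "set_integrable lborel {0..2*pi} ?g"
    by (intro set_integral_add const set_integrable_abs set_integrable_ln_abs_diff)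
  show "AE t in lborel. t \<in> {0..2*pi} \<longrightarrow> norm (ln_sin_half t) \<le> norm (?g t)"
  proof (intro AE_I2 impI)
    fix t :: real assume t: "t \<in> {0..2*pi}"
    show "norm (ln_sin_half t) \<le> norm (?g t)"
    proof (cases "t = 0 \<or> t = 2 * pi")
      case True
      then show ?thesis by (auto simp: ln_sin_half_def)
    next
      case False
      with t have pos: "0 < t" "t < 2 * pi" by auto
      have "t * (2 * pi - t) / (8 * pi) = 2 * ((t / 2) * (pi - t / 2) / (4 * pi))"
        by (simp add: field_simps)
      also have "\<dots> \<le> 2 * sin (t / 2)"
        using sin_ge_parabola[of "t / 2"] pos by simp
      finally have low: "t * (2 * pi - t) / (8 * pi) \<le> 2 * sin (t / 2)" .
      have "0 < t * (2 * pi - t) / (8 * pi)" using pos by simp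
      then have spos: "0 < 2 * sin (t / 2)" using low by linarith
      have "ln (t * (2 * pi - t) / (8 * pi)) \<le> ln (2 * sin (t / 2))"
        using low spos \<open>0 < t * (2 * pi - t) / (8 * pi)\<close> by simp
      also have "ln (t * (2 * pi - t) / (8 * pi)) = ln t + ln (2 * pi - t) - ln (8 * pi)"
        using pos by (simp add: ln_mult ln_div)
      finally have "ln t + ln (2 * pi - t) - ln (8 * pi) \<le> ln (2 * sin (t / 2))" .
      moreover have "ln (2 * sin (t / 2)) \<le> ln 2"
        using spos by simp
      moreover have "ln_sin_half t = ln (2 * sin (t / 2))" "\<bar>t - 2 * pi\<bar> = 2 * pi - t"
        using spos pos by (simp_all add: ln_sin_half_def)
      moreover have "0 \<le> ln (2::real)" by simp
      moreover have "\<bar>y\<bar> \<le> l2 + \<bar>p\<bar> + \<bar>q\<bar> + \<bar>m\<bar>"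
        if "p + q - m \<le> y" "y \<le> l2" "0 \<le> l2" for y l2 p q m :: real
        using that by linarith
      ultimately show ?thesis using pos by (simp add: abs_of_nonneg)
    qed
  qed
qed (auto simp: set_borel_measurable_def)

text \<open>
  Reduce the shift to \<open>b\<close> in \<open>[0, 2\<pi>]\<close>; the part over \<open>[0, b]\<close> that is lost on the left reappears
  over \<open>[2\<pi>, 2\<pi> + b]\<close>.
\<close>

lemma has_integral_periodic_shift:
  fixes g :: "real \<Rightarrow> real"
  assumes per: "\<And>t. g (t + 2 * pi) = g t" and g: "(g has_integral I) {0..2*pi}"
  shows "((\<lambda>t. g (t + a)) has_integral I) {0..2*pi}"
proof -
  interpret periodic_fun_simple g "2 * pi" by standard (rule per)
  define n where "n = \<lfloor>a / (2 * pi)\<rfloor>"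
  define b where "b = a - of_int n * (2 * pi)"
  have "of_int n \<le> a / (2 * pi)" "a / (2 * pi) < of_int n + 1"
    unfolding n_def by linarith+
  then have b: "0 \<le> b" "b \<le> 2 * pi"
    by (auto simp: b_def field_simps)
  have shift: "g (t + a) = g (t + b)" for t
    using plus_of_int[of "t + b" n] by (simp add: b_def algebra_simps)
  have int: "g integrable_on {0..2*pi}" using g by blast
  have "(g has_integral integral {0..b} g) {0..b}"
    by (intro integrable_integral integrable_subinterval_real[OF int]) (use b in auto)
  moreover have "g \<circ> (+) (2 * pi) = g"
    using per by (auto simp: o_def add.commute)
  ultimately have right: "(g has_integral integral {0..b} g) {2*pi..b + 2*pi}"
    using has_integral_shift_Icc_real[of g "2 * pi" "integral {0..b} g" 0 b] by simp
  have left: "(g has_integral integral {b..2*pi} g) {b..2*pi}"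
    by (intro integrable_integral integrable_subinterval_real[OF int]) (use b in auto)
  have "integral {0..b} g + integral {b..2*pi} g = I"
    using Henstock_Kurzweil_Integration.integral_combine[OF b int] integral_unique[OF g] by simp
  then have "(g has_integral I) {b..b + 2*pi}"
    using has_integral_combine[OF _ _ left right] b by (simp add: add.commute)
  then have "(g \<circ> (+) b has_integral I) {0..2*pi}"
    using has_integral_shift_Icc_real[of g b I 0 "2 * pi"] by (simp add: add.commute)
  then show ?thesis
    by (simp add: o_def shift add.commute)
qed

lemma ln_sin_half_double:
  assumes "sin t \<noteq> 0"
  shows "ln_sin_half (2 * t) = ln_sin_half t + ln_sin_half (t + pi)"
proof -
  have "sin t = 2 * sin (t / 2) * cos (t / 2)"
    using sin_double[of "t / 2"] by simp
  moreover have "sin ((t + pi) / 2) = cos (t / 2)"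
    by (simp add: add_divide_distrib sin_add)
  moreover have "2 * \<bar>sin (t / 2)\<bar> \<noteq> 0" "2 * \<bar>cos (t / 2)\<bar> \<noteq> 0"
    using assms calculation by auto
  then have "ln (2 * \<bar>sin (t / 2)\<bar> * (2 * \<bar>cos (t / 2)\<bar>)) =
      ln (2 * \<bar>sin (t / 2)\<bar>) + ln (2 * \<bar>cos (t / 2)\<bar>)" by (simp only: ln_mult simp_thms if_True)
  ultimately show ?thesis
    by (simp add: ln_sin_half_def abs_mult mult_ac)
qed

text \<open>
  Euler's argument: by the duplication formula, \<open>ln_sin_half (2 * t)\<close> is the sum of two translates of
  \<open>ln_sin_half\<close>. Each of the three functions has the same integral \<open>J\<close> over a period, so \<open>J = 2 J\<close>.
\<close>

lemma ln_sin_half_integral: "(ln_sin_half has_integral 0) {0..2*pi}"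
proof -
  define J where "J = integral {0..2*pi} ln_sin_half"
  have J: "(ln_sin_half has_integral J) {0..2*pi}"
    using set_borel_integral_eq_integral(1)[OF set_integrable_ln_sin_half]
    by (simp add: J_def integrable_integral)
  have "ln_sin_half \<circ> (+) (2 * pi) = ln_sin_half"
    using ln_sin_half_periodic by (auto simp: o_def add.commute)
  then have "(ln_sin_half has_integral J) {2*pi..4*pi}"
    using J has_integral_shift_Icc_real[of ln_sin_half "2 * pi" J 0 "2 * pi"] by simp
  then have "(ln_sin_half has_integral (J + J)) {0..4*pi}"
    using has_integral_combine[OF _ _ J, of "4 * pi" J] by simp
  then have "((\<lambda>t. ln_sin_half (2 * t)) has_integral J) {0..2*pi}"
    using has_integral_affinity'[of ln_sin_half "J + J" 0 "4 * pi" 2 0] by (simp add: field_simps)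
  moreover have "((\<lambda>t. ln_sin_half t + ln_sin_half (t + pi)) has_integral (J + J)) {0..2*pi}"
    by (intro has_integral_add J has_integral_periodic_shift ln_sin_half_periodic)
  then have "((\<lambda>t. ln_sin_half (2 * t)) has_integral (J + J)) {0..2*pi}"
  proof (rule has_integral_spike_finite[rotated 2])
    fix t assume t: "t \<in> {0..2*pi} - {0, pi, 2 * pi}"
    have "sin t \<noteq> 0"
    proof (cases "t < pi")
      case True
      then show ?thesis using t sin_gt_zero[of t] by auto
    next
      case False
      then show ?thesis using t sin_gt_zero[of "t - pi"] by auto
    qed
    then show "ln_sin_half (2 * t) = ln_sin_half t + ln_sin_half (t + pi)"
      by (rule ln_sin_half_double)
  qed simp
  ultimately have "J = J + J"
    by (rule has_integral_unique)
  then show ?thesis using J by simp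
qed

lemma set_integrable_ln_sin_half_shift:
  "set_integrable lborel {0..2*pi} (\<lambda>t. ln_sin_half (t + a))"
  "(LBINT t:{0..2*pi}. ln_sin_half (t + a)) = 0"
  "(LBINT t:{0..2*pi}. \<bar>ln_sin_half (t + a)\<bar>) = (LBINT t:{0..2*pi}. \<bar>ln_sin_half t\<bar>)"
proof -
  have abs: "set_integrable lborel {0..2*pi} (\<lambda>t. \<bar>ln_sin_half t\<bar>)"
    by (intro set_integrable_abs set_integrable_ln_sin_half)
  have I: "((\<lambda>t. ln_sin_half (t + a)) has_integral 0) {0..2*pi}"
    by (intro has_integral_periodic_shift ln_sin_half_periodic ln_sin_half_integral)
  have "((\<lambda>t. \<bar>ln_sin_half t\<bar>) has_integral (LBINT t:{0..2*pi}. \<bar>ln_sin_half t\<bar>)) {0..2*pi}"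
    using set_borel_integral_eq_integral[OF abs] by (simp add: integrable_integral)
  then have A: "((\<lambda>t. \<bar>ln_sin_half (t + a)\<bar>) has_integral (LBINT t:{0..2*pi}. \<bar>ln_sin_half t\<bar>)) {0..2*pi}"
    by (rule has_integral_periodic_shift[rotated]) (simp add: ln_sin_half_periodic)
  have "(\<lambda>t. ln_sin_half (t + a)) absolutely_integrable_on {0..2*pi}"
    using I A by (auto simp: absolutely_integrable_on_def integrable_on_def)
  then show int: "set_integrable lborel {0..2*pi} (\<lambda>t. ln_sin_half (t + a))"
    by (intro set_integrable_lborel_if_absolutely_integrable) auto
  show "(LBINT t:{0..2*pi}. ln_sin_half (t + a)) = 0"
    using set_borel_integral_eq_integral(2)[OF int] I by (simp add: integral_unique)
  show "(LBINT t:{0..2*pi}. \<bar>ln_sin_half (t + a)\<bar>) = (LBINT t:{0..2*pi}. \<bar>ln_sin_half t\<bar>)"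
    using set_borel_integral_eq_integral(2)[OF set_integrable_abs[OF int]] A by (simp add: integral_unique)
qed

lemma AE_sin_half_nonzero:
  fixes a :: real
  shows "AE t in lborel. sin ((t + a) / 2) \<noteq> 0"
proof (rule AE_I')
  have "countable ((\<lambda>i::int. of_int i * (2 * pi) - a) ` UNIV)" by simp
  then show "(\<lambda>i::int. of_int i * (2 * pi) - a) ` UNIV \<in> null_sets lborel"
    by (rule countable_imp_null_set_lborel)
  show "{t \<in> space lborel. \<not> sin ((t + a) / 2) \<noteq> 0} \<subseteq> (\<lambda>i::int. of_int i * (2 * pi) - a) ` UNIV"
    by (auto simp: sin_zero_iff_int2 image_iff field_simps)
qed

text \<open>
  With \<open>a = b cos \<alpha>\<close>, the formula for a difference of cosines factors \<open>a - b cos (t - \<phi>)\<close> into \<open>b / 2\<close>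
  and two factors \<open>2 sin (u / 2)\<close>, with \<open>u = t - \<phi> + \<alpha>\<close> and \<open>u = t - \<phi> - \<alpha>\<close>. The logarithms of the sine
  factors integrate to \<open>0\<close>, which makes the result independent of \<open>a\<close>. The bound on the absolute
  value is what Fubini's theorem needs later.
\<close>

lemma ln_linear_cos_integral:
  fixes a b \<phi> :: real
  assumes "\<bar>a\<bar> < b"
  defines "Q \<equiv> (LBINT t:{0..2*pi}. \<bar>ln_sin_half t\<bar>)"
  shows "set_integrable lborel {0..2*pi} (\<lambda>t. ln \<bar>a - b * cos (t - \<phi>)\<bar>)"
    and "(LBINT t:{0..2*pi}. ln \<bar>a - b * cos (t - \<phi>)\<bar>) = 2 * pi * ln (b / 2)"
    and "(LBINT t:{0..2*pi}. \<bar>ln \<bar>a - b * cos (t - \<phi>)\<bar>\<bar>) \<le> 2 * pi * \<bar>ln (b / 2)\<bar> + 2 * Q"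
proof -
  define \<alpha> where "\<alpha> = arccos (a / b)"
  have "b > 0" using assms by simp
  have "cos \<alpha> = a / b"
    using assms \<open>b > 0\<close> by (simp add: \<alpha>_def cos_arccos divide_simps)
  then have a: "a = b * cos \<alpha>" using \<open>b > 0\<close> by simp
  let ?s = "\<lambda>t. ln (b / 2) + (ln_sin_half (t + (\<alpha> - \<phi>)) + ln_sin_half (t + (- \<alpha> - \<phi>)))"
  have const: "set_integrable lborel {0..2*pi} (\<lambda>_. c)" for c :: real
    by (intro borel_integrable_atLeastAtMost') auto
  have constval: "(LBINT t:{0..2*pi}. c) = 2 * pi * c" for c :: real
    by (simp add: set_lebesgue_integral_def)
  have eq: "AE t in lborel. ln \<bar>a - b * cos (t - \<phi>)\<bar> = ?s t"
    using AE_sin_half_nonzero[of "\<alpha> - \<phi>"] AE_sin_half_nonzero[of "- \<alpha> - \<phi>"]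
  proof eventually_elim
    case (elim t)
    have "a - b * cos (t - \<phi>) = b * (cos \<alpha> - cos (t - \<phi>))"
      by (simp add: a right_diff_distrib)
    also have "cos \<alpha> - cos (t - \<phi>) = 2 * sin ((\<alpha> + (t - \<phi>)) / 2) * sin (((t - \<phi>) - \<alpha>) / 2)"
      by (rule cos_diff_cos)
    also have "b * \<dots> = b / 2 * ((2 * sin ((t + (\<alpha> - \<phi>)) / 2)) * (2 * sin ((t + (- \<alpha> - \<phi>)) / 2)))"
      by (simp add: algebra_simps)
    finally show ?case
      using elim \<open>b > 0\<close> by (simp add: ln_sin_half_def abs_mult ln_mult ln_div)
  qed
  note shift_int = set_integrable_ln_sin_half_shift(1)
  note sum_int = set_integral_add(1)[OF shift_int shift_int]
  note abs_shift_int = set_integrable_abs[OF shift_int]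
  note abs_sum_int = set_integral_add(1)[OF abs_shift_int abs_shift_int]
  have s: "set_integrable lborel {0..2*pi} ?s"
    by (intro set_integral_add const set_integrable_ln_sin_half_shift)
  have [measurable]: "(\<lambda>t. ln \<bar>a - b * cos (t - \<phi>)\<bar>) \<in> borel_measurable borel"
    by measurable
  show int: "set_integrable lborel {0..2*pi} (\<lambda>t. ln \<bar>a - b * cos (t - \<phi>)\<bar>)"
    by (rule set_integrable_cong_AE[THEN iffD2, OF _ _ _ _ s])
      (use eq in \<open>auto simp: set_borel_measurable_def\<close>)
  show "(LBINT t:{0..2*pi}. ln \<bar>a - b * cos (t - \<phi>)\<bar>) = 2 * pi * ln (b / 2)"
  proof -
    have "(LBINT t:{0..2*pi}. ln \<bar>a - b * cos (t - \<phi>)\<bar>) = (LBINT t:{0..2*pi}. ?s t)"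
      by (rule set_lebesgue_integral_cong_AE) (use eq in auto)
    also have "\<dots> = 2 * pi * ln (b / 2)"
      by (simp add: set_integral_add(2)[OF const sum_int] set_integral_add(2)[OF shift_int shift_int]
          constval set_integrable_ln_sin_half_shift)
    finally show ?thesis .
  qed
  show "(LBINT t:{0..2*pi}. \<bar>ln \<bar>a - b * cos (t - \<phi>)\<bar>\<bar>) \<le> 2 * pi * \<bar>ln (b / 2)\<bar> + 2 * Q"
  proof -
    let ?u = "\<lambda>t. \<bar>ln (b / 2)\<bar> + (\<bar>ln_sin_half (t + (\<alpha> - \<phi>))\<bar> + \<bar>ln_sin_half (t + (- \<alpha> - \<phi>))\<bar>)"
    have "(LBINT t:{0..2*pi}. \<bar>ln \<bar>a - b * cos (t - \<phi>)\<bar>\<bar>) \<le> (LBINT t:{0..2*pi}. ?u t)"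
      by (rule set_integral_mono_AE)
         (use eq in \<open>auto intro!: set_integrable_abs int set_integral_add const set_integrable_ln_sin_half_shift elim!: eventually_mono\<close>)
    also have "\<dots> = 2 * pi * \<bar>ln (b / 2)\<bar> + 2 * Q"
      by (simp add: set_integral_add(2)[OF const abs_sum_int] set_integral_add(2)[OF abs_shift_int abs_shift_int]
          constval set_integrable_ln_sin_half_shift Q_def)
    finally show ?thesis .
  qed
qed

section \<open>Polar coordinates in the plane\<close>

definition unit_vec :: "real \<Rightarrow> real^2" where
  "unit_vec t = vector [cos t, sin t]"

lemma unit_vec_nth [simp]: "unit_vec t $ 1 = cos t" "unit_vec t $ 2 = sin t"
  by (simp_all add: unit_vec_def)

lemma unit_vec_eq: "unit_vec t = cos t *\<^sub>R axis 1 1 + sin t *\<^sub>R axis 2 1"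
  by (simp add: vec_eq_iff forall_2 axis_def)

lemma continuous_on_unit_vec [continuous_intros]:
  fixes h :: "'a::t2_space \<Rightarrow> real"
  shows "continuous_on S h \<Longrightarrow> continuous_on S (\<lambda>x. unit_vec (h x))"
  unfolding unit_vec_eq by (intro continuous_intros)

lemma borel_measurable_unit_vec [measurable]: "unit_vec \<in> borel_measurable borel"
  by (intro borel_measurable_continuous_onI continuous_intros)

lemma norm_unit_vec [simp]: "norm (unit_vec t) = 1"
  by (simp add: norm_vec_def L2_set_def UNIV_2)

lemma vec2_eq_polar:
  fixes v :: "real^2"
  obtains t where "0 \<le> t" "t < 2 * pi" "v = norm v *\<^sub>R unit_vec t"
proof (cases "v = 0")
  case True
  then show ?thesis using that[of 0] by simp
next
  case False
  have "(norm v)\<^sup>2 = (v $ 1)\<^sup>2 + (v $ 2)\<^sup>2"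
    by (simp add: norm_vec_def L2_set_def UNIV_2)
  then have "(v $ 1 / norm v)\<^sup>2 + (v $ 2 / norm v)\<^sup>2 = (norm v)\<^sup>2 / (norm v)\<^sup>2"
    by (simp only: power_divide add_divide_distrib)
  then have "(v $ 1 / norm v)\<^sup>2 + (v $ 2 / norm v)\<^sup>2 = 1"
    using False by simp
  then obtain t where t: "0 \<le> t" "t < 2 * pi" "v $ 1 / norm v = cos t" "v $ 2 / norm v = sin t"
    by (rule sincos_total_2pi)
  have "v = norm v *\<^sub>R unit_vec t"
    unfolding vec_eq_iff forall_2 using False by (simp add: t(3,4)[symmetric])
  with t(1,2) show ?thesis
    by (rule that)
qed

lemma measurable_vec2 [measurable]:
  "(\<lambda>(a, b). vector [a, b] :: real^2) \<in> borel_measurable (lborel \<Otimes>\<^sub>M lborel)"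
proof -
  have "(\<lambda>(a, b). vector [a, b] :: real^2) = (\<lambda>p. fst p *\<^sub>R axis 1 1 + snd p *\<^sub>R axis 2 1)"
    by (auto simp: vec_eq_iff forall_2 axis_def fun_eq_iff)
  then show ?thesis by simp
qed

text \<open>
  The change to polar coordinates happens on vectors, Fubini's theorem on pairs; this identification
  links the two.
\<close>

lemma lborel_vec2: "lborel = distr (lborel \<Otimes>\<^sub>M lborel) borel (\<lambda>(a, b). vector [a, b] :: real^2)"
proof (rule lborel_eqI)
  show "emeasure (distr (lborel \<Otimes>\<^sub>M lborel) borel (\<lambda>(a, b). vector [a, b] :: real^2)) (box l u)
      = ennreal (\<Prod>b\<in>Basis. (u - l) \<bullet> b)" if le: "\<And>b. b \<in> Basis \<Longrightarrow> l \<bullet> b \<le> u \<bullet> b" for l u :: "real^2"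
  proof -
    have ax: "axis 1 1 \<noteq> (axis 2 1 :: real^2)" by (simp add: axis_eq_axis)
    have B: "(Basis :: (real^2) set) = {axis 1 1, axis 2 1}"
      by (auto simp: Basis_vec_def UNIV_2)
    have lu: "l $ 1 \<le> u $ 1" "l $ 2 \<le> u $ 2"
      using le[of "axis 1 1"] le[of "axis 2 1"] by (simp_all add: B inner_axis)
    have "(\<lambda>(a, b). vector [a, b] :: real^2) -` box l u \<inter> space (lborel \<Otimes>\<^sub>M lborel)
        = {l$1<..<u$1} \<times> {l$2<..<u$2}"
      by (auto simp: box_def B inner_axis space_pair_measure)
    then show ?thesis
      using lu by (simp add: emeasure_distr lborel.emeasure_pair_measure_Times B ax inner_axis ennreal_mult)
  qed
qed simp

text \<open>
  The half-open angle interval makes the polar map injective; its image is the punctured plane and its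
  Jacobian is the radius.
\<close>

lemma polar_change_of_variables:
  fixes F :: "real^2 \<Rightarrow> real"
  defines "S \<equiv> {v :: real^2. 0 < v $ 1 \<and> 0 \<le> v $ 2 \<and> v $ 2 < 2 * pi}"
  shows "(\<lambda>v. v $ 1 * F (v $ 1 *\<^sub>R unit_vec (v $ 2))) absolutely_integrable_on S \<and>
     integral S (\<lambda>v. v $ 1 * F (v $ 1 *\<^sub>R unit_vec (v $ 2))) = b \<longleftrightarrow>
     F absolutely_integrable_on (UNIV - {0}) \<and> integral (UNIV - {0}) F = b"
proof -
  define g :: "real^2 \<Rightarrow> real^2" where "g v = v $ 1 *\<^sub>R unit_vec (v $ 2)" for v
  define g' :: "real^2 \<Rightarrow> real^2 \<Rightarrow> real^2" where
    "g' v h = h $ 1 *\<^sub>R unit_vec (v $ 2) + (v $ 1 * h $ 2) *\<^sub>R vector [- sin (v $ 2), cos (v $ 2)]" for v h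
  have "S \<in> sets borel"
    unfolding S_def by measurable
  then have S: "S \<in> sets lebesgue"
    by simp
  have der: "(g has_derivative g' v) (at v within S)" for v
  proof -
    have nth: "((\<lambda>v :: real^2. v $ i) has_derivative (\<lambda>h. h $ i)) (at v within S)" for i
      by (intro bounded_linear_imp_has_derivative bounded_linear_vec_nth)
    have "((\<lambda>v :: real^2. (v $ 1 * cos (v $ 2)) *\<^sub>R axis 1 1 + (v $ 1 * sin (v $ 2)) *\<^sub>R axis 2 1 :: real^2)
        has_derivative g' v) (at v within S)"
      by (auto intro!: nth derivative_eq_intros simp: g'_def fun_eq_iff vec_eq_iff forall_2 axis_def)
    then show ?thesis
      by (simp add: g_def[abs_def] unit_vec_eq scaleR_add_right)
  qed
  have det: "\<bar>det (matrix (g' v))\<bar> = v $ 1" if "v \<in> S" for v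
  proof -
    have "det (matrix (g' v)) = cos (v $ 2) * (v $ 1 * cos (v $ 2)) + v $ 1 * (sin (v $ 2) * sin (v $ 2))"
      by (simp add: det_2 matrix_def g'_def axis_def)
    also have "\<dots> = v $ 1 * ((cos (v $ 2))\<^sup>2 + (sin (v $ 2))\<^sup>2)"
      by (simp only: power2_eq_square distrib_left mult_ac)
    finally show ?thesis using that by (simp add: S_def)
  qed
  have norm_g: "norm (g v) = v $ 1" if "v \<in> S" for v
    using that by (simp add: g_def S_def)
  have inj: "inj_on g S"
  proof (rule inj_onI)
    fix v w assume vw: "v \<in> S" "w \<in> S" "g v = g w"
    then have 1: "v $ 1 = w $ 1" using norm_g[of v] norm_g[of w] by simp
    then have "unit_vec (v $ 2) = unit_vec (w $ 2)"
      using vw by (simp add: g_def S_def)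
    then have cs: "cos (v $ 2) = cos (w $ 2)" "sin (v $ 2) = sin (w $ 2)"
      by (metis unit_vec_nth)+
    have "v $ 2 = w $ 2"
    proof -
      have "sin (v $ 2) = sin (w $ 2) \<and> cos (v $ 2) = cos (w $ 2)" using cs by simp
      then obtain n where n: "v $ 2 = w $ 2 + 2 * pi * of_int n"
        using sin_cos_eq_iff by blast
      have "\<bar>2 * pi * of_int n\<bar> < 2 * pi"
        using vw n by (auto simp: S_def)
      then have "\<bar>of_int n :: real\<bar> < 1"
        by (simp add: abs_mult)
      then show ?thesis using n by simp
    qed
    with 1 show "v = w" by (simp add: vec_eq_iff forall_2)
  qed
  have image: "g ` S = UNIV - {0}"
  proof (intro equalityI subsetI)
    fix y assume "y \<in> g ` S"
    then show "y \<in> UNIV - {0}" using norm_g by (force simp: S_def)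
  next
    fix y :: "real^2" assume y: "y \<in> UNIV - {0}"
    obtain t where t: "0 \<le> t" "t < 2 * pi" "y = norm y *\<^sub>R unit_vec t"
      by (rule vec2_eq_polar)
    then have "g (vector [norm y, t]) = y"
      by (simp add: g_def)
    moreover have "vector [norm y, t] \<in> S"
      using y t(1,2) by (simp add: S_def)
    ultimately show "y \<in> g ` S"
      by (metis image_eqI)
  qed
  have comp: "(\<lambda>x. vec (h x) :: real^1) absolutely_integrable_on T \<and> integral T (\<lambda>x. vec (h x) :: real^1) = vec b \<longleftrightarrow>
     h absolutely_integrable_on T \<and> integral T h = b" for h :: "real^2 \<Rightarrow> real" and T
  proof (intro conj_cong)
    show ai: "(\<lambda>x. vec (h x) :: real^1) absolutely_integrable_on T \<longleftrightarrow> h absolutely_integrable_on T"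
      by (subst absolutely_integrable_componentwise_iff) (simp add: Basis_vec_def inner_axis)
    assume "h absolutely_integrable_on T"
    then have "(\<lambda>x. vec (h x) :: real^1) integrable_on T"
      using ai set_lebesgue_integral_eq_integral(1) by blast
    then have "integral T (\<lambda>x. vec (h x) :: real^1) $ 1 = integral T h"
      by (subst integral_component_eq_cart[symmetric]) simp_all
    then show "integral T (\<lambda>x. vec (h x) :: real^1) = vec b \<longleftrightarrow> integral T h = b"
      by (auto simp: vec_eq_iff)
  qed
  have "((\<lambda>v. \<bar>det (matrix (g' v))\<bar> *\<^sub>R (vec (F (g v)) :: real^1)) absolutely_integrable_on S) =
      ((\<lambda>v. vec (v $ 1 * F (g v)) :: real^1) absolutely_integrable_on S)"
    by (rule set_integrable_cong) (auto simp: det vec_eq_iff)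
  moreover have "integral S (\<lambda>v. \<bar>det (matrix (g' v))\<bar> *\<^sub>R (vec (F (g v)) :: real^1)) =
      integral S (\<lambda>v. vec (v $ 1 * F (g v)) :: real^1)"
    by (rule Henstock_Kurzweil_Integration.integral_cong) (auto simp: det vec_eq_iff)
  ultimately show ?thesis
    using has_absolute_integral_change_of_variables[OF S der inj, of "\<lambda>y. vec (F y) :: real^1" "vec b"]
    unfolding image comp[where T=S and h="\<lambda>v. v $ 1 * F (g v)", unfolded g_def, symmetric]
      comp[where T="UNIV - {0}" and h=F, symmetric]
    by (simp add: g_def)
qed

lemma polar_coordinates:
  fixes F :: "real^2 \<Rightarrow> real" and p :: "real^2"
  assumes F [measurable]: "F \<in> borel_measurable borel"
  defines "P \<equiv> \<lambda>(r, t). indicator {0<..} r * indicator {0..2*pi} t * (r * F (p + r *\<^sub>R unit_vec t))"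
  shows integrable_polar_iff: "integrable lborel F \<longleftrightarrow> integrable (lborel \<Otimes>\<^sub>M lborel) P"
    and integral_polar: "integrable lborel F \<Longrightarrow> integral\<^sup>L lborel F = integral\<^sup>L (lborel \<Otimes>\<^sub>M lborel) P"
proof -
  let ?S = "{v :: real^2. 0 < v $ 1 \<and> 0 \<le> v $ 2 \<and> v $ 2 < 2 * pi}"
  define F' where "F' y = F (p + y)" for y
  define W where "W v = indicator ?S v * (v $ 1 * F' (v $ 1 *\<^sub>R unit_vec (v $ 2)))" for v :: "real^2"
  have [measurable]: "F' \<in> borel_measurable borel"
    unfolding F'_def by measurable
  have [measurable]: "W \<in> borel_measurable borel"
    unfolding W_def by measurable
  have lebesgue: "h absolutely_integrable_on T \<and> integral T h = b \<longleftrightarrow>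
      integrable lborel (\<lambda>x. indicator T x * h x) \<and> integral\<^sup>L lborel (\<lambda>x. indicator T x * h x) = b"
    if [measurable]: "h \<in> borel_measurable borel" "T \<in> sets borel" for h :: "real^2 \<Rightarrow> real" and T b
  proof (intro conj_cong)
    have meas: "(\<lambda>x. indicator T x * h x) \<in> borel_measurable lborel" by measurable
    show ai: "h absolutely_integrable_on T \<longleftrightarrow> integrable lborel (\<lambda>x. indicator T x * h x)"
      using integrable_completion[OF meas] by (simp add: set_integrable_def)
    assume "integrable lborel (\<lambda>x. indicator T x * h x)"
    then have "set_integrable lborel T h" by (simp add: set_integrable_def)
    from set_borel_integral_eq_integral(2)[OF this]
    show "integral T h = b \<longleftrightarrow> integral\<^sup>L lborel (\<lambda>x. indicator T x * h x) = b"
      by (simp add: set_lebesgue_integral_def)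
  qed
  have drop: "integrable lborel (\<lambda>x. indicator (UNIV - {0}) x * h x) \<longleftrightarrow> integrable lborel h"
     "integral\<^sup>L lborel (\<lambda>x. indicator (UNIV - {0}) x * h x) = integral\<^sup>L lborel h"
    if [measurable]: "h \<in> borel_measurable borel" for h :: "real^2 \<Rightarrow> real"
  proof -
    have "AE x in lborel. indicator (UNIV - {0}) x * h x = h x"
      using AE_lborel_singleton[of "0::real^2"] by eventually_elim (simp add: indicator_def)
    then show "integrable lborel (\<lambda>x. indicator (UNIV - {0}) x * h x) \<longleftrightarrow> integrable lborel h"
     "integral\<^sup>L lborel (\<lambda>x. indicator (UNIV - {0}) x * h x) = integral\<^sup>L lborel h"
      by (intro integrable_cong_AE integral_cong_AE; simp)+
  qed
  have Smeas: "?S \<in> sets borel" by measurable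
  have hmeas: "(\<lambda>v. v $ 1 * F' (v $ 1 *\<^sub>R unit_vec (v $ 2))) \<in> borel_measurable borel"
    by measurable
  have "integrable lborel W \<and> integral\<^sup>L lborel W = b \<longleftrightarrow> integrable lborel F' \<and> integral\<^sup>L lborel F' = b" for b
    using polar_change_of_variables[of F' b] lebesgue[OF hmeas Smeas, of b] lebesgue[of F' "UNIV - {0}" b]
    by (simp add: drop W_def[abs_def])
  then have WF: "integrable lborel W \<longleftrightarrow> integrable lborel F'"
      "integrable lborel F' \<Longrightarrow> integral\<^sup>L lborel W = integral\<^sup>L lborel F'"
    by metis+
  have FF: "integrable lborel F' \<longleftrightarrow> integrable lborel F" "integral\<^sup>L lborel F' = integral\<^sup>L lborel F"
    using integrable_distr_eq[of "(+) p" lborel borel F] integral_distr[of "(+) p" lborel borel F]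
    by (simp_all add: lborel_distr_plus F'_def[abs_def])
  have mvec [measurable]: "(\<lambda>(a, b). vector [a, b] :: real^2) \<in> borel_measurable (lborel \<Otimes>\<^sub>M lborel)"
    by (rule measurable_vec2)
  have WV: "integrable lborel W \<longleftrightarrow> integrable (lborel \<Otimes>\<^sub>M lborel) (\<lambda>x. W ((\<lambda>(a, b). vector [a, b] :: real^2) x))"
    "integral\<^sup>L lborel W = integral\<^sup>L (lborel \<Otimes>\<^sub>M lborel) (\<lambda>x. W ((\<lambda>(a, b). vector [a, b] :: real^2) x))"
    using integrable_distr_eq[OF mvec, of W] integral_distr[OF mvec, of W]
    by (simp_all add: lborel_vec2[symmetric])
  \<comment> \<open>Passing from the half-open to the closed angle interval only adds a null set.\<close>
  have "UNIV \<times> {2 * pi} \<in> null_sets (lborel \<Otimes>\<^sub>M lborel :: (real \<times> real) measure)"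
    by (intro lborel.times_in_null_sets2) auto
  then have "AE x in lborel \<Otimes>\<^sub>M lborel. x \<notin> (UNIV :: real set) \<times> {2 * pi :: real}"
    by (rule AE_not_in)
  then have ae: "AE x in lborel \<Otimes>\<^sub>M lborel. W ((\<lambda>(a, b). vector [a, b] :: real^2) x) = P x"
    by eventually_elim (auto simp: W_def P_def F'_def indicator_def)
  have Pmeas [measurable]: "P \<in> borel_measurable (lborel \<Otimes>\<^sub>M lborel)"
    unfolding P_def by measurable
  have "integrable lborel W \<longleftrightarrow> integrable (lborel \<Otimes>\<^sub>M lborel) P" "integral\<^sup>L lborel W = integral\<^sup>L (lborel \<Otimes>\<^sub>M lborel) P"
    unfolding WV using ae by (intro integrable_cong_AE integral_cong_AE; simp)+
  then show "integrable lborel F \<longleftrightarrow> integrable (lborel \<Otimes>\<^sub>M lborel) P"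
    "integrable lborel F \<Longrightarrow> integral\<^sup>L lborel F = integral\<^sup>L (lborel \<Otimes>\<^sub>M lborel) P"
    using WF FF by simp_all
qed

section \<open>Principal values of Cauchy kernels\<close>

text \<open>
  Dominated convergence: removing a shrinking neighbourhood of one point does not change the integral
  of an integrable function in the limit.
\<close>

lemma pv_truncation_tendsto:
  assumes W: "set_integrable lborel {a..b} W"
  shows "(pv_truncation a b c W \<longlongrightarrow> (LBINT r:{a..b}. W r)) (at_right 0)"
proof (rule tendsto_at_right_sequentially[of 0 1])
  fix S :: "nat \<Rightarrow> real"
  assume S: "\<And>n. 0 < S n" "S \<longlonglongrightarrow> 0"
  let ?T = "\<lambda>n. {a..b} - {c - S n<..<c + S n}"
  show "(\<lambda>n. pv_truncation a b c W (S n)) \<longlonglongrightarrow> (LBINT r:{a..b}. W r)"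
    unfolding pv_truncation_def set_lebesgue_integral_def
  proof (rule integral_dominated_convergence)
    have meas: "(\<lambda>r. indicator {a..b} r *\<^sub>R W r) \<in> borel_measurable lborel"
      using W unfolding set_integrable_def by (rule borel_measurable_integrable)
    then show "(\<lambda>r. indicator {a..b} r *\<^sub>R W r) \<in> borel_measurable lborel" .
    have "(\<lambda>r. indicator (- {c - S n<..<c + S n}) r *\<^sub>R (indicator {a..b} r *\<^sub>R W r)) \<in> borel_measurable lborel" for n
      by (intro borel_measurable_scaleR meas borel_measurable_indicator) auto
    moreover have eq: "indicator (- {c - S n<..<c + S n}) r *\<^sub>R (indicator {a..b} r *\<^sub>R W r) = indicator (?T n) r *\<^sub>R W r" for n r
      by (auto simp: indicator_def)
    ultimately show "(\<lambda>r. indicator (?T n) r *\<^sub>R W r) \<in> borel_measurable lborel" for n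
      by (simp only: eq)
    show "integrable lborel (\<lambda>r. norm (indicator {a..b} r *\<^sub>R W r))"
      using W unfolding set_integrable_def by (rule integrable_norm)
    show "AE r in lborel. norm (indicator (?T n) r *\<^sub>R W r) \<le> norm (indicator {a..b} r *\<^sub>R W r)" for n
      by (rule AE_I2) (auto simp: indicator_def)
    show "AE r in lborel. (\<lambda>n. indicator (?T n) r *\<^sub>R W r) \<longlonglongrightarrow> indicator {a..b} r *\<^sub>R W r"
      using AE_lborel_singleton[of c]
    proof eventually_elim
      case (elim r)
      then have "\<forall>\<^sub>F n in sequentially. S n < \<bar>r - c\<bar>"
        using S(2) by (intro order_tendstoD) auto
      then have "\<forall>\<^sub>F n in sequentially. indicator (?T n) r *\<^sub>R W r = indicator {a..b} r *\<^sub>R W r"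
        by eventually_elim (auto simp: indicator_def)
      then show ?case by (rule tendsto_eventually)
    qed
  qed
qed simp

text \<open>
  The boundary terms at \<open>c - e\<close> and \<open>c + e\<close> in the integration by parts below. The symmetric
  difference is of order \<open>e\<close>, which beats \<open>ln e\<close>.
\<close>

lemma symmetric_difference_times_ln:
  fixes h :: "real \<Rightarrow> real"
  assumes "(h has_real_derivative d) (at c)"
  shows "((\<lambda>e. (h (c + e) - h (c - e)) * ln e) \<longlongrightarrow> 0) (at_right 0)"
proof -
  have "((\<lambda>e. h (c + e) - h (c - e)) has_real_derivative d * 1 - d * (- 1)) (at 0)"
    by (intro DERIV_diff DERIV_chain2[where f=h and g="\<lambda>e. c + e"] DERIV_chain2[where f=h and g="\<lambda>e. c - e"])
      (use assms in \<open>auto intro!: derivative_eq_intros\<close>)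
  then have "((\<lambda>e. (h (c + e) - h (c - e)) / e) \<longlongrightarrow> 2 * d) (at 0)"
    by (simp add: DERIV_def)
  then have "((\<lambda>e. (h (c + e) - h (c - e)) / e) \<longlongrightarrow> 2 * d) (at_right 0)"
    by (rule tendsto_mono[rotated]) (simp add: at_le)
  moreover have "((\<lambda>e::real. e * ln e) \<longlongrightarrow> 0) (at_right 0)"
    by real_asymp
  ultimately have "((\<lambda>e. (h (c + e) - h (c - e)) / e * (e * ln e)) \<longlongrightarrow> 2 * d * 0) (at_right 0)"
    by (rule tendsto_mult)
  moreover have "\<forall>\<^sub>F e in at_right 0. (h (c + e) - h (c - e)) / e * (e * ln e) = (h (c + e) - h (c - e)) * ln e"
    by (auto simp: eventually_at_filter)
  ultimately show ?thesis
    by (simp add: tendsto_cong)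
qed

lemma set_integrable_continuous_times_ln:
  fixes g :: "real \<Rightarrow> real"
  assumes "continuous_on UNIV g"
  shows "set_integrable lborel {a..b} (\<lambda>r. g r * ln \<bar>r - c\<bar>)"
proof -
  have [measurable]: "g \<in> borel_measurable borel"
    using assms by (rule borel_measurable_continuous_onI)
  have "compact (g ` {a..b})"
    by (intro compact_continuous_image continuous_on_subset[OF assms]) auto
  then obtain B where "\<forall>y\<in>g ` {a..b}. norm y \<le> B"
    using compact_imp_bounded bounded_iff by blast
  then have B: "\<bar>g r\<bar> \<le> B" if "r \<in> {a..b}" for r
    using that by auto
  show ?thesis
  proof (rule set_integrable_bound)
    show "set_integrable lborel {a..b} (\<lambda>r. B * ln \<bar>r - c\<bar>)"
      by (intro set_integrable_mult_right set_integrable_ln_abs_diff)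
    show "AE r in lborel. r \<in> {a..b} \<longrightarrow> norm (g r * ln \<bar>r - c\<bar>) \<le> norm (B * ln \<bar>r - c\<bar>)"
      using B by (intro AE_I2 impI) (force simp: abs_mult intro: mult_right_mono order_trans[OF _ abs_ge_self])
  qed (auto simp: set_borel_measurable_def)
qed

text \<open>
  Integration by parts with \<open>- ln |r - c|\<close> as antiderivative of \<open>1 / (c - r)\<close>. The terms at \<open>a\<close> and \<open>b\<close>
  vanish by assumption, and those at \<open>c - e\<close> and \<open>c + e\<close> cancel in the limit because the truncation is
  symmetric about \<open>c\<close>.
\<close>

lemma
  fixes h h' :: "real \<Rightarrow> real"
  assumes c: "a < c" "c < b"
    and h: "\<And>r. (h has_real_derivative h' r) (at r)" and h': "continuous_on UNIV h'"
    and ends: "h a = 0" "h b = 0"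
  shows pv_integrable_Cauchy_kernel: "pv_integrable a b c (\<lambda>r. h r / (c - r))"
    and pv_integral_Cauchy_kernel_tendsto:
      "(pv_truncation a b c (\<lambda>r. h r / (c - r)) \<longlongrightarrow> (LBINT r:{a..b}. h' r * ln \<bar>r - c\<bar>)) (at_right 0)"
proof -
  let ?T = "\<lambda>e. {a..b} - {c - e<..<c + e}"
  let ?W = "\<lambda>r. h' r * ln \<bar>r - c\<bar>"
  let ?V = "\<lambda>r. h r / (c - r) - ?W r"
  have conth: "continuous_on UNIV h"
    using h by (auto intro!: continuous_at_imp_continuous_on DERIV_isCont)
  have W: "set_integrable lborel {a..b} ?W"
    by (intro set_integrable_continuous_times_ln h')
  have int: "set_integrable lborel (?T e) (\<lambda>r. h r / (c - r))" if "e > 0" for e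
    unfolding set_integrable_def
    using that by (intro borel_integrable_compact compact_diff continuous_intros continuous_on_subset[OF conth]) auto
  have V: "(LBINT r:?T e. ?V r) = (h (c + e) - h (c - e)) * ln e" if e: "0 < e" "a < c - e" "c + e < b" for e
  proof -
    have T: "?T e = {a..c - e} \<union> {c + e..b}" using e by auto
    have der: "((\<lambda>r. - (h r * ln \<bar>r - c\<bar>)) has_real_derivative ?V r) (at r)" if "r \<noteq> c" for r
    proof -
      have "((\<lambda>r. ln \<bar>r - c\<bar>) has_real_derivative 1 / (r - c) * 1) (at r)"
        using that by (intro DERIV_chain2[OF DERIV_ln_abs, where g="\<lambda>r. r - c"])
          (auto intro!: derivative_eq_intros)
      from DERIV_minus[OF DERIV_mult[OF h this]] show ?thesis
      proof (rule DERIV_cong)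
        have "h r / (c - r) = - (h r / (r - c))"
          by (metis minus_diff_eq minus_divide_right)
        then show "- (h' r * ln \<bar>r - c\<bar> + 1 / (r - c) * 1 * h r) = ?V r" by simp
      qed
    qed
    have piece: "set_integrable lborel {u..v} ?V" "(LBINT r:{u..v}. ?V r) = h u * ln \<bar>u - c\<bar> - h v * ln \<bar>v - c\<bar>"
      if uv: "u \<le> v" "c \<notin> {u..v}" for u v
    proof -
      show ints: "set_integrable lborel {u..v} ?V"
        using uv by (intro borel_integrable_atLeastAtMost' continuous_intros continuous_on_subset[OF conth] continuous_on_subset[OF h']) auto
      have "(?V has_integral (- (h v * ln \<bar>v - c\<bar>)) - (- (h u * ln \<bar>u - c\<bar>))) {u..v}"
        using uv by (intro fundamental_theorem_of_calculus)
          (auto simp: has_real_derivative_iff_has_vector_derivative[symmetric] intro!: has_field_derivative_at_within der)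
      then show "(LBINT r:{u..v}. ?V r) = h u * ln \<bar>u - c\<bar> - h v * ln \<bar>v - c\<bar>"
        using set_borel_integral_eq_integral(2)[OF ints] by (simp add: integral_unique)
    qed
    show ?thesis
      unfolding T using e piece[of a "c - e"] piece[of "c + e" b] ends
      by (subst set_integral_Un) (auto simp: algebra_simps)
  qed
  have "\<forall>\<^sub>F e in at_right 0. e \<in> {0<..<min (c - a) (b - c)}"
    using c by (intro eventually_at_right_real) auto
  then have "\<forall>\<^sub>F e in at_right 0. pv_truncation a b c ?W e + (h (c + e) - h (c - e)) * ln e
      = pv_truncation a b c (\<lambda>r. h r / (c - r)) e"
  proof eventually_elim
    case (elim e)
    then have e: "0 < e" "a < c - e" "c + e < b" by auto
    have "set_integrable lborel (?T e) ?W"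
      by (rule set_integrable_subset[OF W]) auto
    then show ?case
      using V[OF e] set_integral_diff(2)[OF int[OF e(1)], of ?W] by (simp add: pv_truncation_def)
  qed
  then have "(pv_truncation a b c (\<lambda>r. h r / (c - r)) \<longlongrightarrow> (LBINT r:{a..b}. ?W r) + 0) (at_right 0)"
    by (rule Lim_transform_eventually[rotated])
      (intro tendsto_add pv_truncation_tendsto W symmetric_difference_times_ln[OF h])
  then show lim: "(pv_truncation a b c (\<lambda>r. h r / (c - r)) \<longlongrightarrow> (LBINT r:{a..b}. ?W r)) (at_right 0)"
    by simp
  show "pv_integrable a b c (\<lambda>r. h r / (c - r))"
    unfolding pv_integrable_def using int lim by blast
qed

text \<open>
  Truncate the identity \<open>c g / (c - r) = g + r g / (c - r)\<close> and let the truncation radius tend to \<open>0\<close>;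
  the contribution of \<open>g\<close> alone tends to its integral, which is \<open>0\<close>.
\<close>

lemma pv_kernel_divide_by_radius:
  fixes g :: "real \<Rightarrow> real"
  assumes c: "c \<noteq> 0" and g: "continuous_on UNIV g" and zero: "(LBINT r:{a..b}. g r) = 0"
    and lim: "(pv_truncation a b c (\<lambda>r. r * g r / (c - r)) \<longlongrightarrow> L) (at_right 0)"
  shows "pv_integrable a b c (\<lambda>r. g r / (c - r))"
    and "c * pv_integral a b c (\<lambda>r. g r / (c - r)) = L"
proof -
  let ?T = "\<lambda>e. {a..b} - {c - e<..<c + e}"
  have int: "set_integrable lborel (?T e) (\<lambda>r. g r / (c - r))" "set_integrable lborel (?T e) g"
    "set_integrable lborel (?T e) (\<lambda>r. r * g r / (c - r))" if "e > 0" for e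
    unfolding set_integrable_def
    using that by (intro borel_integrable_compact compact_diff continuous_intros continuous_on_subset[OF g]; auto)+
  have "pv_truncation a b c g e + pv_truncation a b c (\<lambda>r. r * g r / (c - r)) e
      = c * pv_truncation a b c (\<lambda>r. g r / (c - r)) e" if e: "e > 0" for e
  proof -
    have "pv_truncation a b c g e + pv_truncation a b c (\<lambda>r. r * g r / (c - r)) e
        = (LBINT r:?T e. g r + r * g r / (c - r))"
      unfolding pv_truncation_def using int[OF e] by (simp add: set_integral_add(2))
    also have "\<dots> = (LBINT r:?T e. c * (g r / (c - r)))"
      using e by (intro set_lebesgue_integral_cong) (auto simp: divide_simps algebra_simps)
    also have "\<dots> = c * (LBINT r:?T e. g r / (c - r))"
      by (rule set_integral_mult_right)
    finally show ?thesis by (simp only: pv_truncation_def)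
  qed
  then have "\<forall>\<^sub>F e in at_right 0. (pv_truncation a b c g e + pv_truncation a b c (\<lambda>r. r * g r / (c - r)) e) / c
      = pv_truncation a b c (\<lambda>r. g r / (c - r)) e"
    using c by (auto simp: eventually_at_filter field_simps)
  moreover have "set_integrable lborel {a..b} g"
    by (intro borel_integrable_atLeastAtMost' continuous_on_subset[OF g]) auto
  then have "((\<lambda>e. (pv_truncation a b c g e + pv_truncation a b c (\<lambda>r. r * g r / (c - r)) e) / c) \<longlongrightarrow> (0 + L) / c) (at_right 0)"
    using pv_truncation_tendsto[of a b g c] by (intro tendsto_intros lim c) (simp add: zero)
  ultimately have *: "(pv_truncation a b c (\<lambda>r. g r / (c - r)) \<longlongrightarrow> L / c) (at_right 0)"
    by (simp add: tendsto_cong)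
  then show "pv_integrable a b c (\<lambda>r. g r / (c - r))"
    unfolding pv_integrable_def using int(1) by blast
  have "pv_integral a b c (\<lambda>r. g r / (c - r)) = L / c"
    unfolding pv_integral_def by (rule tendsto_Lim[OF _ *]) simp
  then show "c * pv_integral a b c (\<lambda>r. g r / (c - r)) = L"
    using c by simp
qed

section \<open>Circular means and the Darboux equation\<close>

text \<open>
  Passing from arc length \<open>s\<close> to the angle \<open>t = s / R\<close> gives the factor \<open>R\<close>. Measurability is assumed on
  the circle only, since the integrands of interest are controlled only there.
\<close>

lemma arc_length_measure_integral:
  fixes F :: "real^2 \<Rightarrow> real"
  assumes R: "R > 0" and F: "F \<in> borel_measurable (restrict_space borel (sphere 0 R))"
  shows integrable_arc_length_measure: "integrable (arc_length_measure R) F \<longleftrightarrow>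
      set_integrable lborel {0..2*pi} (\<lambda>t. F (R *\<^sub>R unit_vec t))"
    and integral_arc_length_measure: "integral\<^sup>L (arc_length_measure R) F =
      R * (LBINT t:{0..2*pi}. F (R *\<^sub>R unit_vec t))"
proof -
  let ?C = "restrict_space borel (sphere 0 R) :: (real^2) measure"
  let ?h = "\<lambda>s. R *\<^sub>R unit_vec (s / R)"
  have h_eq: "(\<lambda>s. vector [R * cos (s / R), R * sin (s / R)]) = ?h"
    by (auto simp: fun_eq_iff vec_eq_iff forall_2)
  have circ: "(\<lambda>t. R *\<^sub>R unit_vec (c * t)) \<in> measurable borel ?C" for c
    by (rule measurable_restrict_space2) (use R in auto)
  have "?h \<in> measurable lborel ?C"
    using circ[of "1 / R"] by (simp add: measurable_lborel1)
  then have h: "?h \<in> measurable (restrict_space lborel {0..<2*pi*R}) ?C"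
    by (rule measurable_restrict_space1)
  have [measurable]: "(\<lambda>t. F (R *\<^sub>R unit_vec t)) \<in> borel_measurable borel"
    using measurable_compose[OF circ[of 1] F] by simp
  have scale: "indicator {0..<2*pi*R} (0 + R * t) *\<^sub>R F (?h (0 + R * t)) =
      indicator {0..<2*pi} t *\<^sub>R F (R *\<^sub>R unit_vec t)" for t
    using R by (auto simp: indicator_def zero_le_mult_iff mult.commute[of R])
  have ae: "AE t in lborel. indicator {0..<2*pi} t *\<^sub>R F (R *\<^sub>R unit_vec t) =
      indicator {0..2*pi} t *\<^sub>R F (R *\<^sub>R unit_vec t)"
    using AE_lborel_singleton[of "2 * pi"] by eventually_elim (auto simp: indicator_def)
  have "integrable (arc_length_measure R) F \<longleftrightarrow>
      integrable lborel (\<lambda>s. indicator {0..<2*pi*R} s *\<^sub>R F (?h s))"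
    unfolding arc_length_measure_def h_eq
    by (simp add: integrable_distr_eq[OF h F] integrable_restrict_space)
  also have "\<dots> \<longleftrightarrow> integrable lborel (\<lambda>t. indicator {0..<2*pi} t *\<^sub>R F (R *\<^sub>R unit_vec t))"
    using lborel_integrable_real_affine_iff[of R "\<lambda>s. indicator {0..<2*pi*R} s *\<^sub>R F (?h s)" 0] R
    unfolding scale by simp
  also have "\<dots> \<longleftrightarrow> set_integrable lborel {0..2*pi} (\<lambda>t. F (R *\<^sub>R unit_vec t))"
    unfolding set_integrable_def by (rule integrable_cong_AE) (use ae in auto)
  finally show "integrable (arc_length_measure R) F \<longleftrightarrow>
      set_integrable lborel {0..2*pi} (\<lambda>t. F (R *\<^sub>R unit_vec t))" .
  have "integral\<^sup>L (arc_length_measure R) F =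
      integral\<^sup>L lborel (\<lambda>s. indicator {0..<2*pi*R} s *\<^sub>R F (?h s))"
    unfolding arc_length_measure_def h_eq
    by (simp add: integral_distr[OF h F] integral_restrict_space)
  also have "\<dots> = R * integral\<^sup>L lborel (\<lambda>t. indicator {0..<2*pi} t *\<^sub>R F (R *\<^sub>R unit_vec t))"
    using lborel_integral_real_affine[of R "\<lambda>s. indicator {0..<2*pi*R} s *\<^sub>R F (?h s)" 0] R
    unfolding scale by simp
  also have "integral\<^sup>L lborel (\<lambda>t. indicator {0..<2*pi} t *\<^sub>R F (R *\<^sub>R unit_vec t)) =
      (LBINT t:{0..2*pi}. F (R *\<^sub>R unit_vec t))"
    unfolding set_lebesgue_integral_def by (rule integral_cong_AE) (use ae in auto)
  finally show "integral\<^sup>L (arc_length_measure R) F =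
      R * (LBINT t:{0..2*pi}. F (R *\<^sub>R unit_vec t))" .
qed

lemma circular_mean_eq_integral:
  fixes f :: "real^2 \<Rightarrow> real"
  assumes "continuous_on UNIV f"
  shows "circular_mean f p r = 1 / (2 * pi) * (LBINT t:{0..2*pi}. f (p + r *\<^sub>R unit_vec t))"
    and "circular_mean f p r = 1 / (2 * pi) * integral {0..2*pi} (\<lambda>t. f (p + r *\<^sub>R unit_vec t))"
proof -
  have [measurable]: "f \<in> borel_measurable borel"
    using assms by (rule borel_measurable_continuous_onI)
  have "(\<lambda>\<theta>. f (p + r *\<^sub>R \<theta>)) \<in> borel_measurable (restrict_space borel (sphere 0 1))"
    by (rule measurable_restrict_space1) measurable
  from integral_arc_length_measure[OF _ this]
  show leb: "circular_mean f p r = 1 / (2 * pi) * (LBINT t:{0..2*pi}. f (p + r *\<^sub>R unit_vec t))"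
    by (simp add: circular_mean_def)
  have "set_integrable lborel {0..2*pi} (\<lambda>t. f (p + r *\<^sub>R unit_vec t))"
    by (intro borel_integrable_atLeastAtMost' continuous_on_compose2[OF assms] continuous_intros) auto
  then show "circular_mean f p r = 1 / (2 * pi) * integral {0..2*pi} (\<lambda>t. f (p + r *\<^sub>R unit_vec t))"
    unfolding leb by (simp add: set_borel_integral_eq_integral(2))
qed

lemma continuous_circular_mean:
  fixes u :: "real^2 \<Rightarrow> real"
  assumes u: "continuous_on UNIV u"
  shows "continuous_on UNIV (circular_mean u p)"
proof -
  have "continuous_on UNIV (\<lambda>r. integral (cbox 0 (2*pi)) (\<lambda>t. u (p + r *\<^sub>R unit_vec t)))"
    by (rule integral_continuous_on_param)
      (auto intro!: continuous_intros continuous_on_compose2[OF u] simp: split_beta)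
  from continuous_on_mult_left[OF this, of "1 / (2 * pi)"] show ?thesis
    by (simp add: circular_mean_eq_integral(2)[OF u, abs_def])
qed

lemma DERIV_along_ray:
  fixes g :: "real^2 \<Rightarrow> real"
  assumes "(g has_derivative (\<lambda>h. h $ 1 * a + h $ 2 * b)) (at (p + r *\<^sub>R unit_vec t))"
  shows "((\<lambda>r. g (p + r *\<^sub>R unit_vec t)) has_real_derivative cos t * a + sin t * b) (at r)"
proof -
  have "((\<lambda>r. p + r *\<^sub>R unit_vec t) has_derivative (\<lambda>h. h *\<^sub>R unit_vec t)) (at r)"
    by (auto intro!: derivative_eq_intros)
  from has_derivative_compose[OF this assms] show ?thesis
    by (rule has_derivative_imp_has_field_derivative) (simp add: algebra_simps)
qed

lemma DERIV_along_circle: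
  fixes g :: "real^2 \<Rightarrow> real"
  assumes "(g has_derivative (\<lambda>h. h $ 1 * a + h $ 2 * b)) (at (p + r *\<^sub>R unit_vec t))"
  shows "((\<lambda>t. g (p + r *\<^sub>R unit_vec t)) has_real_derivative r * (cos t * b - sin t * a)) (at t)"
proof -
  have "((\<lambda>t. p + r *\<^sub>R unit_vec t) has_derivative (\<lambda>h. (h * r) *\<^sub>R vector [- sin t, cos t])) (at t)"
    unfolding unit_vec_eq by (auto intro!: derivative_eq_intros simp: vec_eq_iff forall_2 axis_def)
  from has_derivative_compose[OF this assms] show ?thesis
    by (rule has_derivative_imp_has_field_derivative) (simp add: algebra_simps)
qed

text \<open>
  A twice continuously differentiable function together with its partial derivatives as explicit
  functions, so that derivatives along rays and circles become trigonometric combinations of them.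
\<close>

locale C2_plane =
  fixes f fx fy fxx fxy fyx fyy :: "real^2 \<Rightarrow> real"
  assumes f_deriv: "\<And>y. (f has_derivative (\<lambda>h. h $ 1 * fx y + h $ 2 * fy y)) (at y)"
    and fx_deriv: "\<And>y. (fx has_derivative (\<lambda>h. h $ 1 * fxx y + h $ 2 * fxy y)) (at y)"
    and fy_deriv: "\<And>y. (fy has_derivative (\<lambda>h. h $ 1 * fyx y + h $ 2 * fyy y)) (at y)"
    and second_continuous: "continuous_on UNIV fxx" "continuous_on UNIV fxy"
      "continuous_on UNIV fyx" "continuous_on UNIV fyy"
begin

definition laplacian :: "real^2 \<Rightarrow> real" where
  "laplacian y = fxx y + fyy y"

text \<open>
  The derivative of the circular mean of \<open>f\<close> with respect to the radius, see \<open>circular_mean_deriv\<close>.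
\<close>

definition radial_mean :: "real^2 \<Rightarrow> real \<Rightarrow> real" where
  "radial_mean p r = 1 / (2 * pi) * integral {0..2*pi}
     (\<lambda>t. cos t * fx (p + r *\<^sub>R unit_vec t) + sin t * fy (p + r *\<^sub>R unit_vec t))"

lemma first_continuous: "continuous_on UNIV f" "continuous_on UNIV fx" "continuous_on UNIV fy"
  by (auto intro!: continuous_at_imp_continuous_on has_derivative_continuous[OF f_deriv]
      has_derivative_continuous[OF fx_deriv] has_derivative_continuous[OF fy_deriv])

lemma continuous_laplacian: "continuous_on UNIV laplacian"
  unfolding laplacian_def[abs_def] by (intro continuous_intros second_continuous)

lemma continuous_on_partials [continuous_intros]:
  fixes h :: "'a::t2_space \<Rightarrow> real^2"
  assumes "continuous_on S h"
  shows "continuous_on S (\<lambda>x. f (h x))" "continuous_on S (\<lambda>x. fx (h x))" "continuous_on S (\<lambda>x. fy (h x))"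
    "continuous_on S (\<lambda>x. fxx (h x))" "continuous_on S (\<lambda>x. fxy (h x))"
    "continuous_on S (\<lambda>x. fyx (h x))" "continuous_on S (\<lambda>x. fyy (h x))" "continuous_on S (\<lambda>x. laplacian (h x))"
  by (auto intro!: continuous_on_compose2[OF _ assms] first_continuous second_continuous continuous_laplacian)

lemma circular_mean_deriv: "(circular_mean f p has_real_derivative radial_mean p r) (at r)"
proof -
  have "((\<lambda>r. integral (cbox 0 (2*pi)) (\<lambda>t. f (p + r *\<^sub>R unit_vec t))) has_real_derivative
      integral (cbox 0 (2*pi)) (\<lambda>t. cos t * fx (p + r *\<^sub>R unit_vec t) + sin t * fy (p + r *\<^sub>R unit_vec t)))
      (at r within UNIV)"
    by (rule leibniz_rule_field_derivative)
      (auto intro!: DERIV_along_ray f_deriv continuous_intros integrable_continuous_real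
        simp: split_beta)
  from DERIV_cmult[OF this, of "1 / (2 * pi)"] show ?thesis
    by (simp add: circular_mean_eq_integral(2)[OF first_continuous(1), abs_def] radial_mean_def)
qed

text \<open>
  The integrand is the derivative in \<open>t\<close> of the tangential component of the gradient along the circle,
  a \<open>2\<pi>\<close>-periodic function.
\<close>

lemma angular_derivative_integral_zero:
  "integral {0..2*pi} (\<lambda>t. r * (cos t * (cos t * fyy (p + r *\<^sub>R unit_vec t) - sin t * fyx (p + r *\<^sub>R unit_vec t))
      - sin t * (cos t * fxy (p + r *\<^sub>R unit_vec t) - sin t * fxx (p + r *\<^sub>R unit_vec t)))
      - (cos t * fx (p + r *\<^sub>R unit_vec t) + sin t * fy (p + r *\<^sub>R unit_vec t))) = 0"
    (is "integral _ ?q = 0")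
proof -
  have "((\<lambda>t. cos t * fy (p + r *\<^sub>R unit_vec t) - sin t * fx (p + r *\<^sub>R unit_vec t)) has_real_derivative ?q t) (at t)" for t
    by (rule derivative_eq_intros DERIV_along_circle fx_deriv fy_deriv refl)+ (simp add: algebra_simps)
  then have "(?q has_integral (cos (2*pi) * fy (p + r *\<^sub>R unit_vec (2*pi)) - sin (2*pi) * fx (p + r *\<^sub>R unit_vec (2*pi)))
      - (cos 0 * fy (p + r *\<^sub>R unit_vec 0) - sin 0 * fx (p + r *\<^sub>R unit_vec 0))) {0..2*pi}"
    by (intro fundamental_theorem_of_calculus)
      (auto simp: has_real_derivative_iff_has_vector_derivative[symmetric] intro: has_field_derivative_at_within)
  moreover have "unit_vec (2 * pi) = unit_vec 0"
    by (simp add: unit_vec_def)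
  ultimately show ?thesis by (simp add: integral_unique)
qed

text \<open>
  In polar coordinates the Laplacian is a radial part plus \<open>1 / r\<^sup>2\<close> times the second angular derivative,
  and the latter has mean zero on every circle. Writing the angular part as \<open>?q\<close> and adding its
  vanishing integral turns the derivative of \<open>r * radial_mean p r\<close> into the mean of \<open>r \<Delta>f\<close>. With the
  radius kept as a factor, the equation holds at \<open>r = 0\<close> too.
\<close>

lemma darboux_equation: "((\<lambda>r. r * radial_mean p r) has_real_derivative r * circular_mean laplacian p r) (at r)"
proof -
  let ?y = "\<lambda>r t. p + r *\<^sub>R unit_vec t"
  let ?g = "\<lambda>r t. cos t * fx (?y r t) + sin t * fy (?y r t)"
  let ?g' = "\<lambda>r t. cos t * (cos t * fxx (?y r t) + sin t * fxy (?y r t))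
      + sin t * (cos t * fyx (?y r t) + sin t * fyy (?y r t))"
  let ?q = "\<lambda>t. r * (cos t * (cos t * fyy (?y r t) - sin t * fyx (?y r t))
      - sin t * (cos t * fxy (?y r t) - sin t * fxx (?y r t))) - ?g r t"
  have int: "?g r integrable_on {0..2*pi}" "?g' r integrable_on {0..2*pi}" "?q integrable_on {0..2*pi}"
    by (auto intro!: integrable_continuous_real continuous_intros)
  have g_deriv: "((\<lambda>r. ?g r t) has_real_derivative ?g' r t) (at r)" for r t
    by (intro DERIV_add DERIV_cmult DERIV_along_ray fx_deriv fy_deriv)
  have "((\<lambda>r. integral (cbox 0 (2*pi)) (?g r)) has_real_derivative integral (cbox 0 (2*pi)) (?g' r)) (at r within UNIV)"
    by (rule leibniz_rule_field_derivative)
      (auto intro!: g_deriv continuous_intros integrable_continuous_real simp: split_beta)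
  from DERIV_mult[OF DERIV_ident DERIV_cmult[OF this, of "1 / (2 * pi)"]]
  have D: "((\<lambda>r. r * radial_mean p r) has_real_derivative
      1 / (2 * pi) * (integral {0..2*pi} (?g r) + r * integral {0..2*pi} (?g' r))) (at r)"
    by (simp add: radial_mean_def[abs_def] field_simps)
  have "((\<lambda>t. ?g r t + r * ?g' r t + ?q t) has_integral
      (integral {0..2*pi} (?g r) + r * integral {0..2*pi} (?g' r) + integral {0..2*pi} ?q)) {0..2*pi}"
    by (intro has_integral_add has_integral_mult_right integrable_integral int)
  then have "integral {0..2*pi} (?g r) + r * integral {0..2*pi} (?g' r)
      = integral {0..2*pi} (\<lambda>t. ?g r t + r * ?g' r t + ?q t)"
    using angular_derivative_integral_zero[of r p] by (simp only: integral_unique add_0_right)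
  also have "\<dots> = integral {0..2*pi} (\<lambda>t. r * laplacian (?y r t))"
  proof (rule Henstock_Kurzweil_Integration.integral_cong)
    fix t
    have "r * laplacian (?y r t) = r * ((cos t)\<^sup>2 + (sin t)\<^sup>2) * (fxx (?y r t) + fyy (?y r t))"
      by (simp add: laplacian_def)
    also have "\<dots> = ?g r t + r * ?g' r t + ?q t"
      unfolding power2_eq_square by (simp only: algebra_simps)
    finally show "?g r t + r * ?g' r t + ?q t = r * laplacian (?y r t)" by simp
  qed
  finally show ?thesis
    using D by (simp add: circular_mean_eq_integral(2)[OF continuous_laplacian])
qed

end

lemma has_derivative_partials:
  fixes g :: "real^2 \<Rightarrow> real"
  assumes "g differentiable (at y)"
  shows "(g has_derivative (\<lambda>h. h $ 1 * frechet_derivative g (at y) (axis 1 1)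
      + h $ 2 * frechet_derivative g (at y) (axis 2 1))) (at y)"
proof -
  have der: "(g has_derivative frechet_derivative g (at y)) (at y)"
    using assms by (simp add: frechet_derivative_works)
  then have lin: "linear (frechet_derivative g (at y))"
    by (rule has_derivative_linear)
  have eq: "frechet_derivative g (at y) h = h $ 1 * frechet_derivative g (at y) (axis 1 1)
      + h $ 2 * frechet_derivative g (at y) (axis 2 1)" for h
  proof -
    have "h = h $ 1 *\<^sub>R axis 1 1 + h $ 2 *\<^sub>R axis 2 1"
      by (simp add: vec_eq_iff forall_2 axis_def)
    then have "frechet_derivative g (at y) h = frechet_derivative g (at y) (h $ 1 *\<^sub>R axis 1 1 + h $ 2 *\<^sub>R axis 2 1)"
      by simp
    then show ?thesis
      by (simp add: linear_add[OF lin] linear_cmul[OF lin])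
  qed
  show ?thesis
    by (rule has_derivative_eq_rhs[OF der]) (rule ext, rule eq)
qed

text \<open>
  The second unfolding step of the recursive definition supplies exactly the partial derivatives up to
  order two and the continuity of those of order two.
\<close>

lemma C_infinity_imp_C2_plane:
  assumes "C_infinity f"
  shows "\<exists>fx fy fxx fxy fyx fyy. C2_plane f fx fy fxx fxy fyx fyy"
proof -
  define D :: "real^2 \<Rightarrow> (real^2 \<Rightarrow> real) \<Rightarrow> real^2 \<Rightarrow> real" where
    "D v g = (\<lambda>y. frechet_derivative g (at y) v)" for v g
  have "C_k (Suc (Suc 0)) f"
    using assms unfolding C_infinity_def by blast
  then have f: "\<And>y. f differentiable (at y)" and Df: "\<And>v y. D v f differentiable (at y)"
    and DDf: "\<And>v w. continuous_on UNIV (D w (D v f))"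
    by (simp_all add: D_def)
  have "C2_plane f (D (axis 1 1) f) (D (axis 2 1) f) (D (axis 1 1) (D (axis 1 1) f)) (D (axis 2 1) (D (axis 1 1) f))
      (D (axis 1 1) (D (axis 2 1) f)) (D (axis 2 1) (D (axis 2 1) f))"
    using has_derivative_partials[OF f] has_derivative_partials[OF Df] DDf
    by unfold_locales (simp_all add: D_def)
  then show ?thesis by blast
qed

section \<open>Integrals with a radial weight\<close>

text \<open>
  Polar coordinates about \<open>p\<close> followed by Fubini's theorem. The hypothesis on the integrability of \<open>w\<close>
  does not involve the factor \<open>r\<close>, since \<open>r\<close> is bounded on \<open>[0, A]\<close>.
\<close>

lemma
  fixes u :: "real^2 \<Rightarrow> real"
  assumes u: "continuous_on UNIV u" and far: "\<And>y. norm (y - p) > A \<Longrightarrow> u y = 0"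
    and w [measurable]: "w \<in> borel_measurable borel" and wint: "set_integrable lborel {0..A} w"
  shows integrable_radial_weight: "integrable lborel (\<lambda>y. u y * w (norm (y - p)))"
    and integral_radial_weight: "(\<integral>y. u y * w (norm (y - p)) \<partial>lborel) =
      2 * pi * (LBINT r:{0..A}. r * circular_mean u p r * w r)"
proof -
  define P :: "real \<times> real \<Rightarrow> real" where
    "P = (\<lambda>(r, t). indicator {0..A} r * (indicator {0..2*pi} t * (r * w r * u (p + r *\<^sub>R unit_vec t))))"
  have [measurable]: "u \<in> borel_measurable borel"
    using u by (rule borel_measurable_continuous_onI)
  have [measurable]: "P \<in> borel_measurable (lborel \<Otimes>\<^sub>M lborel)"
    unfolding P_def by measurable
  have "compact (u ` cball p A)"
    by (intro compact_continuous_image continuous_on_subset[OF u]) auto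
  then obtain B where B': "\<forall>y\<in>u ` cball p A. norm y \<le> B"
    using compact_imp_bounded bounded_iff by blast
  then have B: "\<bar>u (p + r *\<^sub>R unit_vec t)\<bar> \<le> B" if "r \<in> {0..A}" for r t
    using that by (auto simp: dist_norm)
  have circle: "set_integrable lborel {0..2*pi} (\<lambda>t. c * u (p + r *\<^sub>R unit_vec t))" for c r
    by (intro borel_integrable_atLeastAtMost' continuous_intros continuous_on_compose2[OF u]) auto
  have inner_int: "integrable lborel (\<lambda>t. P (r, t))" for r
    using circle[of "indicator {0..A} r * (r * w r)" r]
    unfolding P_def set_integrable_def by (simp add: mult_ac)
  have inner_bound: "norm (\<integral>t. norm (P (r, t)) \<partial>lborel) \<le> indicator {0..A} r * (A * B * 2 * pi * \<bar>w r\<bar>)" for r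
  proof (cases "r \<in> {0..A}")
    case True
    have "0 \<le> B" using B[OF True, of 0] by linarith
    have "norm (\<integral>t. norm (P (r, t)) \<partial>lborel) = (\<integral>t. norm (P (r, t)) \<partial>lborel)"
      by simp
    also have "\<dots> \<le> (\<integral>t. indicator {0..2*pi} t * (A * \<bar>w r\<bar> * B) \<partial>lborel)"
    proof (rule integral_mono)
      show "integrable lborel (\<lambda>t. norm (P (r, t)))"
        by (intro integrable_norm inner_int)
      show "integrable lborel (\<lambda>t. indicator {0..2*pi} t * (A * \<bar>w r\<bar> * B))"
        by simp
      show "norm (P (r, t)) \<le> indicator {0..2*pi} t * (A * \<bar>w r\<bar> * B)" for t
        using True B[OF True, of t] \<open>0 \<le> B\<close>
        by (auto simp: P_def indicator_def abs_mult intro!: mult_mono)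
    qed
    also have "\<dots> = 2 * pi * (A * \<bar>w r\<bar> * B)"
      by simp
    finally show ?thesis using True by (simp add: mult_ac)
  qed (simp add: P_def)
  have P_int: "integrable (lborel \<Otimes>\<^sub>M lborel) P"
  proof (rule lborel_pair.Fubini_integrable)
    show "integrable lborel (\<lambda>r. \<integral>t. norm (P (r, t)) \<partial>lborel)"
    proof (rule Bochner_Integration.integrable_bound)
      show "integrable lborel (\<lambda>r. indicator {0..A} r * (A * B * 2 * pi * \<bar>w r\<bar>))"
        using set_integrable_mult_right[OF set_integrable_abs[OF wint], of "A * B * 2 * pi"]
        by (simp add: set_integrable_def)
      show "AE r in lborel. norm (\<integral>t. norm (P (r, t)) \<partial>lborel) \<le> norm (indicator {0..A} r * (A * B * 2 * pi * \<bar>w r\<bar>))"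
        using order_trans[OF inner_bound abs_ge_self] by simp
    qed measurable
  qed (use inner_int in auto)
  have polar: "(\<lambda>(r, t). indicator {0<..} r * indicator {0..2*pi} t *
      (r * (u (p + r *\<^sub>R unit_vec t) * w (norm (p + r *\<^sub>R unit_vec t - p))))) = P"
    using far by (auto simp: P_def fun_eq_iff indicator_def)
  have F [measurable]: "(\<lambda>y. u y * w (norm (y - p))) \<in> borel_measurable borel"
    by measurable
  show int: "integrable lborel (\<lambda>y. u y * w (norm (y - p)))"
    using integrable_polar_iff[OF F, of p] P_int unfolding polar by simp
  have "(\<integral>y. u y * w (norm (y - p)) \<partial>lborel) = integral\<^sup>L (lborel \<Otimes>\<^sub>M lborel) P"
    using integral_polar[OF F int, of p] unfolding polar .
  also have "\<dots> = (\<integral>r. (\<integral>t. P (r, t) \<partial>lborel) \<partial>lborel)"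
    using lborel_pair.integral_fst'[OF P_int] by simp
  also have "\<dots> = (\<integral>r. indicator {0..A} r * (r * w r * (2 * pi * circular_mean u p r)) \<partial>lborel)"
  proof (rule Bochner_Integration.integral_cong[OF refl])
    fix r
    have "(\<integral>t. P (r, t) \<partial>lborel) = indicator {0..A} r * (r * w r) * (LBINT t:{0..2*pi}. u (p + r *\<^sub>R unit_vec t))"
      unfolding P_def set_lebesgue_integral_def by (simp flip: integral_mult_right_zero add: mult_ac)
    also have "\<dots> = indicator {0..A} r * (r * w r * (2 * pi * circular_mean u p r))"
      by (simp add: circular_mean_eq_integral(1)[OF u])
    finally show "(\<integral>t. P (r, t) \<partial>lborel) = indicator {0..A} r * (r * w r * (2 * pi * circular_mean u p r))" .
  qed
  also have "\<dots> = 2 * pi * (LBINT r:{0..A}. r * circular_mean u p r * w r)"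
    unfolding set_lebesgue_integral_def by (simp flip: integral_mult_right_zero add: mult_ac)
  finally show "(\<integral>y. u y * w (norm (y - p)) \<partial>lborel) =
      2 * pi * (LBINT r:{0..A}. r * circular_mean u p r * w r)" .
qed

text \<open>
  On the sphere itself, approach \<open>y\<close> from outside along the ray through \<open>y\<close>.
\<close>

lemma vanishing_on_sphere:
  fixes g :: "real^2 \<Rightarrow> real"
  assumes g: "continuous_on UNIV g" and out: "\<And>y. norm y > R \<Longrightarrow> g y = 0" and R: "R > 0" and y: "norm y \<ge> R"
  shows "g y = 0"
proof (rule tendsto_unique[OF trivial_limit_at_right_real])
  have "isCont (\<lambda>s::real. g ((1 + s) *\<^sub>R y)) 0"
  proof -
    have "continuous_on UNIV (\<lambda>s::real. g ((1 + s) *\<^sub>R y))"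
      by (intro continuous_on_compose2[OF g] continuous_intros) auto
    then show ?thesis by (simp add: continuous_on_eq_continuous_at)
  qed
  then show "((\<lambda>s. g ((1 + s) *\<^sub>R y)) \<longlongrightarrow> g y) (at_right 0)"
    by (simp add: isCont_def filterlim_at_split)
  have "g ((1 + s) *\<^sub>R y) = 0" if "s > 0" for s
    using that y R by (intro out) (auto intro: less_le_trans[of R "(1+s) * R"])
  then show "((\<lambda>s. g ((1 + s) *\<^sub>R y)) \<longlongrightarrow> 0) (at_right 0)"
    by (intro tendsto_eventually) (auto simp: eventually_at_filter)
qed

lemma derivative_vanishing_outside:
  fixes g :: "real^2 \<Rightarrow> real"
  assumes der: "(g has_derivative (\<lambda>h. h $ 1 * a + h $ 2 * b)) (at y)"
    and out: "\<And>y. norm y > R \<Longrightarrow> g y = 0" and y: "norm y > R"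
  shows "a = 0" "b = 0"
proof -
  have "open {y :: real^2. norm y > R}"
    by (intro open_Collect_less continuous_intros)
  then have "(g has_derivative (\<lambda>h. 0)) (at y)"
    using y by (intro has_derivative_transform_within_open[OF has_derivative_const[of 0]]) (auto simp: out)
  from has_derivative_unique[OF der this]
  have "(axis i 1 :: real^2) $ 1 * a + (axis i 1 :: real^2) $ 2 * b = 0" for i
    by meson
  from this[of 1] this[of 2] show "a = 0" "b = 0"
    by (simp_all add: axis_def)
qed

lemma ln_abs_square_difference:
  assumes "r \<ge> 0" "c > 0" "r \<noteq> (c::real)"
  shows "ln \<bar>r\<^sup>2 - c\<^sup>2\<bar> = ln \<bar>r - c\<bar> + ln \<bar>- r - c\<bar>"
proof -
  have "r\<^sup>2 - c\<^sup>2 = (r - c) * (r + c)" by (simp add: power2_eq_square algebra_simps)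
  then show ?thesis using assms by (simp add: abs_mult ln_mult)
qed

lemma set_integrable_ln_abs_square_difference:
  fixes c :: real
  assumes "c > 0"
  shows "set_integrable lborel {0..A} (\<lambda>r. ln \<bar>r\<^sup>2 - c\<^sup>2\<bar>)"
proof (rule set_integrable_cong_AE[THEN iffD2])
  show "set_integrable lborel {0..A} (\<lambda>r. ln \<bar>r - c\<bar> + ln \<bar>r - (- c)\<bar>)"
    by (intro set_integral_add set_integrable_ln_abs_diff)
  show "AE r\<in>{0..A} in lborel. ln \<bar>r\<^sup>2 - c\<^sup>2\<bar> = ln \<bar>r - c\<bar> + ln \<bar>r - (- c)\<bar>"
    using AE_lborel_singleton[of c]
  proof eventually_elim
    case (elim r)
    then show ?case
      using ln_abs_square_difference[of r c] assms by (auto simp: abs_minus_commute add.commute)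
  qed
qed auto

text \<open>
  Reflecting \<open>[-A, 0]\<close> onto \<open>[0, A]\<close> turns \<open>ln |r - c|\<close> into \<open>ln |r + c|\<close>, and the two logarithms add up
  to \<open>ln |r\<^sup>2 - c\<^sup>2|\<close>.
\<close>

lemma even_log_kernel_fold:
  fixes k :: "real \<Rightarrow> real"
  assumes k: "continuous_on UNIV k" and c: "c > 0" and A: "A \<ge> 0"
  shows "(LBINT r:{- A..A}. k \<bar>r\<bar> * ln \<bar>r - c\<bar>) = (LBINT r:{0..A}. k r * ln \<bar>r\<^sup>2 - c\<^sup>2\<bar>)"
proof -
  let ?F = "\<lambda>r. k \<bar>r\<bar> * ln \<bar>r - c\<bar>"
  have kabs: "continuous_on UNIV (\<lambda>r. k \<bar>r\<bar>)"
    by (intro continuous_on_compose2[OF k] continuous_intros) auto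
  have F: "set_integrable lborel {u..v} ?F" for u v
    by (rule set_integrable_continuous_times_ln[OF kabs])
  note hk = set_borel_integral_eq_integral
  have Fm: "set_integrable lborel {0..A} (\<lambda>r. ?F (- r))"
  proof -
    have "set_integrable lborel {0..A} (\<lambda>r. k \<bar>r\<bar> * ln \<bar>r - (- c)\<bar>)"
      by (rule set_integrable_continuous_times_ln[OF kabs])
    moreover have "\<bar>- r - c\<bar> = \<bar>r - (- c)\<bar>" for r by simp
    ultimately show ?thesis by simp
  qed
  have "(LBINT r:{- A..A}. ?F r) = integral {- A..A} ?F"
    by (rule hk(2)[OF F])
  also have "\<dots> = integral {- A..0} ?F + integral {0..A} ?F"
    using Henstock_Kurzweil_Integration.integral_combine[OF _ _ hk(1)[OF F], of "- A" 0 A] A by simp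
  also have "integral {- A..0} ?F = integral {0..A} (\<lambda>r. ?F (- r))"
    using Henstock_Kurzweil_Integration.integral_reflect_real[of A 0 "\<lambda>r. ?F (- r)"] by simp
  also have "\<dots> + integral {0..A} ?F = (LBINT r:{0..A}. ?F (- r)) + (LBINT r:{0..A}. ?F r)"
    by (simp only: hk(2)[OF F] hk(2)[OF Fm])
  also have "\<dots> = (LBINT r:{0..A}. ?F (- r) + ?F r)"
    by (rule set_integral_add(2)[OF Fm F, symmetric])
  also have "\<dots> = (LBINT r:{0..A}. k r * ln \<bar>r\<^sup>2 - c\<^sup>2\<bar>)"
  proof (rule set_lebesgue_integral_cong_AE)
    have [measurable]: "k \<in> borel_measurable borel"
      using k by (rule borel_measurable_continuous_onI)
    show "(\<lambda>r. ?F (- r) + ?F r) \<in> borel_measurable lborel" "(\<lambda>r. k r * ln \<bar>r\<^sup>2 - c\<^sup>2\<bar>) \<in> borel_measurable lborel"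
      by measurable
    show "AE r\<in>{0..A} in lborel. ?F (- r) + ?F r = k r * ln \<bar>r\<^sup>2 - c\<^sup>2\<bar>"
      using AE_lborel_singleton[of c]
      by eventually_elim (auto simp: ln_abs_square_difference c algebra_simps)
  qed simp
  finally show ?thesis .
qed

section \<open>Functions supported in a disk\<close>

locale C2_disk = C2_plane +
  fixes R :: real
  assumes R_pos: "R > 0" and f_outside: "\<And>y. norm y > R \<Longrightarrow> f y = 0"
begin

lemma vanish_outside_disk:
  assumes "norm y \<ge> R"
  shows "f y = 0" "fx y = 0" "fy y = 0" "laplacian y = 0"
proof -
  have first: "fx y = 0" "fy y = 0" if "norm y > R" for y
    using derivative_vanishing_outside[OF f_deriv f_outside that] by auto
  have lap: "laplacian y = 0" if "norm y > R" for y
    using derivative_vanishing_outside(1)[OF fx_deriv first(1) that]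
      derivative_vanishing_outside(2)[OF fy_deriv first(2) that] by (simp add: laplacian_def)
  show "f y = 0" "fx y = 0" "fy y = 0" "laplacian y = 0"
    using vanishing_on_sphere[OF first_continuous(1) f_outside R_pos assms]
      vanishing_on_sphere[OF first_continuous(2) first(1) R_pos assms]
      vanishing_on_sphere[OF first_continuous(3) first(2) R_pos assms]
      vanishing_on_sphere[OF continuous_laplacian lap R_pos assms] by auto
qed

text \<open>
  Used for the radius \<open>0\<close>, when \<open>p\<close> lies on the boundary circle, and for the radius \<open>2 * R\<close>: in both cases
  the whole circle stays outside the open disk.
\<close>

lemma means_vanish:
  assumes "\<And>t. norm (p + r *\<^sub>R unit_vec t) \<ge> R"
  shows "circular_mean f p r = 0" "radial_mean p r = 0"
  by (simp_all add: circular_mean_eq_integral(2)[OF first_continuous(1)] radial_mean_def vanish_outside_disk assms)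

lemma norm_large_circle:
  assumes "norm p \<le> R"
  shows "norm (p + (2 * R) *\<^sub>R unit_vec t) \<ge> R"
  using norm_triangle_ineq2[of "(2 * R) *\<^sub>R unit_vec t" "- p"] assms R_pos by (simp add: add.commute)

lemma laplacian_far:
  assumes "norm p \<le> R" "norm (y - p) > 2 * R"
  shows "laplacian y = 0"
  using norm_triangle_ineq4[of y p] assms by (intro vanish_outside_disk(4)) linarith

lemma continuous_on_means: "continuous_on UNIV (circular_mean f p)" "continuous_on UNIV (radial_mean p)"
  "continuous_on UNIV (circular_mean laplacian p)"
proof -
  have "continuous_on UNIV (\<lambda>r. integral (cbox 0 (2*pi))
      (\<lambda>t. cos t * fx (p + r *\<^sub>R unit_vec t) + sin t * fy (p + r *\<^sub>R unit_vec t)))"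
    by (rule integral_continuous_on_param) (auto intro!: continuous_intros simp: split_beta)
  then show "continuous_on UNIV (radial_mean p)"
    unfolding radial_mean_def[abs_def] by (intro continuous_on_mult_left) simp
qed (intro continuous_circular_mean first_continuous continuous_laplacian)+

text \<open>
  The fundamental solution of the Laplacian, after passing to circular means about \<open>x\<close>. By the Darboux
  equation the integrand is the derivative of \<open>?\<Psi>\<close>, which vanishes at \<open>2 * R\<close> and equals \<open>- f x\<close> at \<open>0\<close>,
  where the mean over the degenerate circle is \<open>f x\<close>. The constant \<open>k\<close> does not affect the value because
  \<open>\<Delta>f\<close> has integral zero.
\<close>

lemma potential_recovers_f:
  assumes "norm x \<le> R"
  shows "(LBINT r:{0..2*R}. r * circular_mean laplacian x r * (k + ln \<bar>r\<bar>)) = f x"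
proof -
  let ?L = "\<lambda>r. r * circular_mean laplacian x r * (k + ln \<bar>r\<bar>)"
  let ?\<Psi> = "\<lambda>r. radial_mean x r * (r * ln \<bar>r\<bar>) + k * (r * radial_mean x r) - circular_mean f x r"
  have "set_integrable lborel {0..2*R} (\<lambda>r. k * (r * circular_mean laplacian x r) + (r * circular_mean laplacian x r) * ln \<bar>r - 0\<bar>)"
    by (intro set_integral_add set_integrable_continuous_times_ln borel_integrable_atLeastAtMost' continuous_intros
      continuous_on_subset[OF continuous_on_means(3)]) auto
  then have int: "set_integrable lborel {0..2*R} ?L"
    by (simp add: algebra_simps)
  have "continuous_on UNIV (\<lambda>r::real. r * ln \<bar>r\<bar>)"
    by (intro continuous_at_imp_continuous_on ballI isCont_times_ln_abs)
  from continuous_on_diff[OF continuous_on_add[OF continuous_on_mult[OF continuous_on_means(2) this]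
      continuous_on_mult_left[OF continuous_on_mult[OF continuous_on_id continuous_on_means(2)]]] continuous_on_means(1)]
  have cont: "continuous_on {0..2*R} ?\<Psi>"
    by (rule continuous_on_subset) simp
  have der: "(?\<Psi> has_real_derivative ?L r) (at r)" if "r > 0" for r
  proof -
    have "((\<lambda>r. ((r * radial_mean x r) * (k + ln \<bar>r\<bar>)) - circular_mean f x r) has_real_derivative
       (r * circular_mean laplacian x r * (k + ln \<bar>r\<bar>) + (0 + 1 / r) * (r * radial_mean x r)) - radial_mean x r) (at r)"
      using that by (intro DERIV_diff DERIV_mult DERIV_add DERIV_const DERIV_ln_abs darboux_equation circular_mean_deriv) auto
    then show ?thesis
      using that by (simp add: algebra_simps)
  qed
  have "(?L has_integral (?\<Psi> (2 * R) - ?\<Psi> 0)) {0..2*R}"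
    using R_pos der cont by (intro fundamental_theorem_of_calculus_interior)
      (auto simp: has_real_derivative_iff_has_vector_derivative[symmetric])
  moreover have "?\<Psi> (2 * R) = 0"
    using means_vanish[OF norm_large_circle[OF assms]] by simp
  moreover have "?\<Psi> 0 = - f x"
    by (simp add: circular_mean_eq_integral(2)[OF first_continuous(1)])
  ultimately show ?thesis
    using set_borel_integral_eq_integral(2)[OF int] by (simp add: integral_unique)
qed

text \<open>
  Up to the factor \<open>2\<pi>\<close>, the common value at the boundary point \<open>p\<close> of the two inner principal values,
  the second taken with its factor \<open>|x - p|\<close>.
  Being a parametric integral, it is defined and measurable in \<open>p\<close> on the whole plane.
\<close>

definition log_potential :: "real^2 \<Rightarrow> real^2 \<Rightarrow> real" where
  "log_potential x p = (\<integral>y. laplacian y * ln \<bar>(norm (y - p))\<^sup>2 - (norm (x - p))\<^sup>2\<bar> \<partial>lborel)"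

lemma borel_measurable_laplacian [measurable]: "laplacian \<in> borel_measurable borel"
  using continuous_laplacian by (rule borel_measurable_continuous_onI)

lemma borel_measurable_log_potential [measurable]: "log_potential x \<in> borel_measurable borel"
  unfolding log_potential_def by measurable

text \<open>
  The odd extension has an even derivative. At \<open>r = 0\<close> the two branches fit together because \<open>f\<close>
  vanishes at \<open>p\<close>, so that there is no jump.
\<close>

lemma dr_circular_mean_eq:
  assumes p: "norm p = R"
  shows "dr_circular_mean f p r = radial_mean p \<bar>r\<bar>"
proof -
  have M0: "circular_mean f p 0 = 0" and G0: "radial_mean p 0 = 0"
    by (intro means_vanish; simp add: p)+
  have "(odd_extension (circular_mean f p) has_real_derivative radial_mean p \<bar>r\<bar>) (at r)"
  proof -
    have pos: "(circular_mean f p has_real_derivative radial_mean p r) (at r)"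
      by (rule circular_mean_deriv)
    have neg: "((\<lambda>r. - circular_mean f p (- r)) has_real_derivative radial_mean p (- r)) (at r)"
      using DERIV_minus[OF DERIV_chain2[OF circular_mean_deriv[of p "- r"] DERIV_minus[OF DERIV_ident]]] by simp
    consider "r > 0" | "r < 0" | "r = 0" by linarith
    then show ?thesis
    proof cases
      case 1
      with pos have "(circular_mean f p has_real_derivative radial_mean p \<bar>r\<bar>) (at r)"
        by simp
      then show ?thesis
        by (rule has_field_derivative_transform_within_open[OF _ open_greaterThan[of 0]])
          (use 1 in \<open>auto simp: odd_extension_def\<close>)
    next
      case 2
      with neg have "((\<lambda>r. - circular_mean f p (- r)) has_real_derivative radial_mean p \<bar>r\<bar>) (at r)"
        by simp
      then show ?thesis
        by (rule has_field_derivative_transform_within_open[OF _ open_lessThan[of 0]])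
          (use 2 in \<open>auto simp: odd_extension_def\<close>)
    next
      case 3
      have eq: "odd_extension (circular_mean f p) = (\<lambda>r. if r \<in> {0..} then circular_mean f p r else - circular_mean f p (- r))"
        by (auto simp: odd_extension_def)
      have "((\<lambda>r. if r \<in> {0..} then circular_mean f p r else - circular_mean f p (- r)) has_vector_derivative
          (if (0::real) \<in> {0..} then radial_mean p 0 else radial_mean p (- 0))) (at 0 within UNIV)"
      proof (rule has_vector_derivative_If_within_closures[where S="{0..}" and T="{..0}"
            and f'="\<lambda>r. radial_mean p r" and g'="\<lambda>r. radial_mean p (- r)"])
        show "(circular_mean f p has_vector_derivative radial_mean p 0) (at 0 within T)" for T
          using pos 3 by (auto simp: has_real_derivative_iff_has_vector_derivative intro: has_vector_derivative_at_within)
        show "((\<lambda>r. - circular_mean f p (- r)) has_vector_derivative radial_mean p (- 0)) (at 0 within T)" for T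
          using neg 3 by (auto simp: has_real_derivative_iff_has_vector_derivative intro: has_vector_derivative_at_within)
      qed (auto simp: M0)
      then show ?thesis
        using 3 by (simp add: eq has_real_derivative_iff_has_vector_derivative)
    qed
  qed
  then show ?thesis
    unfolding dr_circular_mean_def by (rule DERIV_imp_deriv)
qed

text \<open>
  The Darboux equation for the even extension of the radial derivative. At \<open>r = 0\<close> differentiability
  follows from the continuity of the radial derivative and its value \<open>0\<close> there.
\<close>

lemma weighted_derivative:
  assumes p: "norm p = R"
  shows "((\<lambda>r. r * radial_mean p \<bar>r\<bar>) has_real_derivative \<bar>r\<bar> * circular_mean laplacian p \<bar>r\<bar>) (at r)"
proof -
  have G0: "radial_mean p 0 = 0"
    by (intro means_vanish) (simp add: p)
  have pos: "((\<lambda>r. r * radial_mean p r) has_real_derivative r * circular_mean laplacian p r) (at r)"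
    by (rule darboux_equation)
  have neg: "((\<lambda>r. - (- r * radial_mean p (- r))) has_real_derivative - r * circular_mean laplacian p (- r)) (at r)"
    using DERIV_minus[OF DERIV_chain2[OF darboux_equation[of p "- r"] DERIV_minus[OF DERIV_ident]]] by simp
  consider "r > 0" | "r < 0" | "r = 0" by linarith
  then show ?thesis
  proof cases
    case 1
    with pos have "((\<lambda>r. r * radial_mean p r) has_real_derivative \<bar>r\<bar> * circular_mean laplacian p \<bar>r\<bar>) (at r)"
      by simp
    then show ?thesis
      by (rule has_field_derivative_transform_within_open[OF _ open_greaterThan[of 0]]) (use 1 in auto)
  next
    case 2
    with neg have "((\<lambda>r. - (- r * radial_mean p (- r))) has_real_derivative \<bar>r\<bar> * circular_mean laplacian p \<bar>r\<bar>) (at r)"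
      by simp
    then show ?thesis
      by (rule has_field_derivative_transform_within_open[OF _ open_lessThan[of 0]]) (use 2 in auto)
  next
    case 3
    have "isCont (\<lambda>r. radial_mean p \<bar>r\<bar>) 0"
      using continuous_on_compose2[OF continuous_on_means(2)[of p], of UNIV abs]
      by (simp add: continuous_on_eq_continuous_at continuous_intros)
    then have "((\<lambda>h. radial_mean p \<bar>h\<bar>) \<longlongrightarrow> 0) (at 0)"
      by (simp add: isCont_def G0)
    then have "((\<lambda>h. h * radial_mean p \<bar>h\<bar> / h) \<longlongrightarrow> 0) (at 0)"
      by (rule Lim_transform_eventually) (auto simp: eventually_at_filter)
    then show ?thesis using 3 by (simp add: DERIV_def)
  qed
qed

text \<open>
  Integration by parts for the kernel with the factor \<open>r\<close>, then folding onto \<open>[0, 2 * R]\<close> and polar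
  coordinates about \<open>p\<close>. The kernel without this factor follows because the radial derivative has
  integral zero over \<open>[-2R, 2R]\<close>.
\<close>

lemma
  assumes x: "norm x < R" and p: "norm p = R"
  defines "c \<equiv> norm (x - p)"
  shows pv_integrable_weighted_kernel: "pv_integrable (-2 * R) (2 * R) c (\<lambda>r. r * dr_circular_mean f p r / (c - r))"
    and pv_integral_weighted_kernel: "pv_integral (-2 * R) (2 * R) c (\<lambda>r. r * dr_circular_mean f p r / (c - r)) =
      1 / (2 * pi) * log_potential x p"
    and pv_integrable_plain_kernel: "pv_integrable (-2 * R) (2 * R) c (\<lambda>r. dr_circular_mean f p r / (c - r))"
    and pv_integral_plain_kernel: "c * pv_integral (-2 * R) (2 * R) c (\<lambda>r. dr_circular_mean f p r / (c - r)) =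
      1 / (2 * pi) * log_potential x p"
proof -
  let ?L = "\<lambda>r. r * circular_mean laplacian p r"
  have c: "0 < c" "c < 2 * R"
    using norm_triangle_ineq4[of x p] x p by (auto simp: c_def)
  have Labs: "continuous_on UNIV (\<lambda>r. \<bar>r\<bar> * circular_mean laplacian p \<bar>r\<bar>)"
    by (intro continuous_intros continuous_on_compose2[OF continuous_on_means(3)]) auto
  have L: "continuous_on UNIV ?L"
    by (intro continuous_intros continuous_on_means)
  have Gabs: "continuous_on UNIV (\<lambda>r. radial_mean p \<bar>r\<bar>)"
    by (intro continuous_intros continuous_on_compose2[OF continuous_on_means(2)]) auto
  have G_end: "radial_mean p (2 * R) = 0" and M_end: "circular_mean f p (2 * R) = 0"
    using means_vanish[OF norm_large_circle[of p]] p by auto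
  have M0: "circular_mean f p 0 = 0"
    by (intro means_vanish) (simp add: p)
  have ab: "- 2 * R < c" "c < 2 * R" using c by linarith+
  have ends: "- 2 * R * radial_mean p \<bar>- 2 * R\<bar> = 0" "2 * R * radial_mean p \<bar>2 * R\<bar> = 0"
    using G_end R_pos by (simp_all add: abs_mult)
  have fold: "(LBINT r:{-2*R..2*R}. \<bar>r\<bar> * circular_mean laplacian p \<bar>r\<bar> * ln \<bar>r - c\<bar>) = 1 / (2 * pi) * log_potential x p"
  proof -
    have "(LBINT r:{- (2*R)..2*R}. \<bar>r\<bar> * circular_mean laplacian p \<bar>r\<bar> * ln \<bar>r - c\<bar>)
        = (LBINT r:{0..2*R}. r * circular_mean laplacian p r * ln \<bar>r\<^sup>2 - c\<^sup>2\<bar>)"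
      by (rule even_log_kernel_fold[OF L]) (use c R_pos in auto)
    moreover have "log_potential x p = 2 * pi * (LBINT r:{0..2*R}. r * circular_mean laplacian p r * ln \<bar>r\<^sup>2 - c\<^sup>2\<bar>)"
      unfolding log_potential_def c_def[symmetric]
      by (rule integral_radial_weight[OF continuous_laplacian laplacian_far])
        (use p c in \<open>auto intro: set_integrable_ln_abs_square_difference\<close>)
    ultimately show ?thesis by simp
  qed
  have lim: "(pv_truncation (-2*R) (2*R) c (\<lambda>r. r * radial_mean p \<bar>r\<bar> / (c - r)) \<longlongrightarrow> 1 / (2 * pi) * log_potential x p) (at_right 0)"
    using pv_integral_Cauchy_kernel_tendsto[OF ab weighted_derivative[OF p] Labs ends] unfolding fold .
  note dr = dr_circular_mean_eq[OF p]
  show "pv_integrable (-2 * R) (2 * R) c (\<lambda>r. r * dr_circular_mean f p r / (c - r))"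
    unfolding dr by (rule pv_integrable_Cauchy_kernel[OF ab weighted_derivative[OF p] Labs ends])
  show "pv_integral (-2 * R) (2 * R) c (\<lambda>r. r * dr_circular_mean f p r / (c - r)) = 1 / (2 * pi) * log_potential x p"
    unfolding dr pv_integral_def by (rule tendsto_Lim[OF _ lim]) simp
  have zero: "(LBINT r:{-2*R..2*R}. radial_mean p \<bar>r\<bar>) = 0"
  proof -
    have half: "integral {0..2*R} (radial_mean p) = 0"
    proof -
      have "(radial_mean p has_integral circular_mean f p (2 * R) - circular_mean f p 0) {0..2*R}"
        using R_pos by (intro fundamental_theorem_of_calculus)
          (auto simp: has_real_derivative_iff_has_vector_derivative[symmetric] intro!: has_field_derivative_at_within circular_mean_deriv)
      then show ?thesis using M_end M0 by (simp add: integral_unique)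
    qed
    have "set_integrable lborel {-2*R..2*R} (\<lambda>r. radial_mean p \<bar>r\<bar>)"
      by (intro borel_integrable_atLeastAtMost' continuous_on_subset[OF Gabs]) auto
    then have "(LBINT r:{-2*R..2*R}. radial_mean p \<bar>r\<bar>) = integral {-2*R..2*R} (\<lambda>r. radial_mean p \<bar>r\<bar>)"
      by (rule set_borel_integral_eq_integral(2))
    also have "\<dots> = integral {-2*R..0} (\<lambda>r. radial_mean p \<bar>r\<bar>) + integral {0..2*R} (\<lambda>r. radial_mean p \<bar>r\<bar>)"
      using R_pos by (intro Henstock_Kurzweil_Integration.integral_combine[symmetric] integrable_continuous_real continuous_on_subset[OF Gabs]) auto
    also have "integral {-2*R..0} (\<lambda>r. radial_mean p \<bar>r\<bar>) = integral {0..2*R} (\<lambda>r. radial_mean p \<bar>r\<bar>)"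
      using Henstock_Kurzweil_Integration.integral_reflect_real[of "2*R" 0 "\<lambda>r. radial_mean p \<bar>r\<bar>"] by simp
    also have "integral {0..2*R} (\<lambda>r. radial_mean p \<bar>r\<bar>) = integral {0..2*R} (radial_mean p)"
      by (rule Henstock_Kurzweil_Integration.integral_cong) auto
    finally show ?thesis using half by simp
  qed
  have "c \<noteq> 0" using c by simp
  from pv_kernel_divide_by_radius[OF this Gabs zero lim]
  show "pv_integrable (-2 * R) (2 * R) c (\<lambda>r. dr_circular_mean f p r / (c - r))"
    "c * pv_integral (-2 * R) (2 * R) c (\<lambda>r. dr_circular_mean f p r / (c - r)) = 1 / (2 * pi) * log_potential x p"
    unfolding dr by auto
qed

end

section \<open>Integration over the boundary circle\<close>

text \<open>
  For distinct points \<open>x\<close>, \<open>y\<close> of the open disk the perpendicular bisector of \<open>x\<close> and \<open>y\<close> crosses the circle, which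
  is the condition \<open>|a| < b\<close>. It follows from \<open>| |y| - |x| | \<le> |y - x|\<close> and \<open>|y| + |x| < 2 R\<close>.
\<close>

lemma ln_distance_difference_circle_mean:
  fixes x y :: "real^2"
  assumes x: "norm x < R" and y: "norm y < R" and ne: "y \<noteq> x"
  defines "k \<equiv> \<lambda>t. ln \<bar>(norm (y - R *\<^sub>R unit_vec t))\<^sup>2 - (norm (x - R *\<^sub>R unit_vec t))\<^sup>2\<bar>"
  shows "set_integrable lborel {0..2*pi} k"
    and "(LBINT t:{0..2*pi}. k t) = 2 * pi * (ln R + ln (norm (y - x)))"
    and "(LBINT t:{0..2*pi}. \<bar>k t\<bar>) \<le>
      2 * pi * \<bar>ln R + ln (norm (y - x))\<bar> + 2 * (LBINT t:{0..2*pi}. \<bar>ln_sin_half t\<bar>)"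
proof -
  obtain \<phi> where \<phi>: "y - x = norm (y - x) *\<^sub>R unit_vec \<phi>"
    by (rule vec2_eq_polar)
  define a where "a = (norm y)\<^sup>2 - (norm x)\<^sup>2"
  define b where "b = 2 * R * norm (y - x)"
  have R: "R > 0" using x norm_ge_zero[of x] by linarith
  have d: "norm (y - x) > 0" using ne by simp
  have "\<bar>norm y - norm x\<bar> \<le> norm (y - x)"
    by (rule norm_triangle_ineq3)
  moreover have "norm y + norm x < 2 * R" using x y by simp
  moreover have "\<bar>a\<bar> = \<bar>norm y - norm x\<bar> * (norm y + norm x)"
    by (simp add: a_def power2_eq_square square_diff_square_factored abs_mult)
  ultimately have "\<bar>a\<bar> \<le> norm (y - x) * (norm y + norm x)"
    by (simp add: mult_right_mono)
  also have "\<dots> < b"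
    using d \<open>norm y + norm x < 2 * R\<close> by (simp add: b_def)
  finally have ab: "\<bar>a\<bar> < b" .
  have "(norm (y - R *\<^sub>R unit_vec t))\<^sup>2 - (norm (x - R *\<^sub>R unit_vec t))\<^sup>2 = a - b * cos (t - \<phi>)" for t
  proof -
    have "(norm (y - R *\<^sub>R unit_vec t))\<^sup>2 - (norm (x - R *\<^sub>R unit_vec t))\<^sup>2
        = a - 2 * R * ((y - x) \<bullet> unit_vec t)"
      unfolding a_def power2_norm_eq_inner by (simp add: algebra_simps inner_commute)
    also have "(y - x) \<bullet> unit_vec t = norm (y - x) * (unit_vec \<phi> \<bullet> unit_vec t)"
      by (subst \<phi>) simp
    also have "unit_vec \<phi> \<bullet> unit_vec t = cos (t - \<phi>)"
      by (simp add: inner_vec_def UNIV_2 cos_diff mult.commute)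
    finally show ?thesis by (simp add: b_def)
  qed
  then have k: "k = (\<lambda>t. ln \<bar>a - b * cos (t - \<phi>)\<bar>)"
    by (simp add: k_def)
  have lnb: "ln (b / 2) = ln R + ln (norm (y - x))"
    using R d by (simp add: b_def ln_mult)
  show "set_integrable lborel {0..2*pi} k"
    and "(LBINT t:{0..2*pi}. k t) = 2 * pi * (ln R + ln (norm (y - x)))"
    and "(LBINT t:{0..2*pi}. \<bar>k t\<bar>) \<le>
      2 * pi * \<bar>ln R + ln (norm (y - x))\<bar> + 2 * (LBINT t:{0..2*pi}. \<bar>ln_sin_half t\<bar>)"
    unfolding k using ln_linear_cos_integral[OF ab, of \<phi>] unfolding lnb by auto
qed

context C2_disk
begin

text \<open>
  Exchanging the order of integration. The fibre over \<open>y\<close> (integration over the circle) is computed by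
  the preceding lemma, and the absolute integrals over the fibres are dominated by \<open>|\<Delta>f(y)|\<close> times a
  constant plus a multiple of \<open>| ln R + ln |y - x| |\<close>, which is integrable in the plane.
\<close>

lemma log_potential_circle_mean:
  assumes x: "norm x < R"
  shows "set_integrable lborel {0..2*pi} (\<lambda>t. log_potential x (R *\<^sub>R unit_vec t))"
    and "(LBINT t:{0..2*pi}. log_potential x (R *\<^sub>R unit_vec t)) = 4 * pi\<^sup>2 * f x"
proof -
  define Q where "Q = (LBINT t:{0..2*pi}. \<bar>ln_sin_half t\<bar>)"
  define K where "K y t = ln \<bar>(norm (y - R *\<^sub>R unit_vec t))\<^sup>2 - (norm (x - R *\<^sub>R unit_vec t))\<^sup>2\<bar>" for y t
  define \<Phi> where "\<Phi> = (\<lambda>(y, t). indicator {0..2*pi} t * (laplacian y * K y t))"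
  define w1 where "w1 r = 2 * pi * (ln R + ln \<bar>r\<bar>)" for r
  define w2 where "w2 r = \<bar>w1 r\<bar> + 2 * Q" for r
  have K_meas [measurable]: "case_prod K \<in> borel_measurable (lborel \<Otimes>\<^sub>M lborel)"
    unfolding K_def by measurable
  have [measurable]: "\<Phi> \<in> borel_measurable (lborel \<Otimes>\<^sub>M lborel)"
    unfolding \<Phi>_def by measurable
  have w_meas [measurable]: "w1 \<in> borel_measurable borel" "w2 \<in> borel_measurable borel"
    unfolding w1_def w2_def by measurable
  have const: "set_integrable lborel {0..2*R} (\<lambda>_. c)" for c :: real
    by (intro borel_integrable_atLeastAtMost') auto
  have w1_int: "set_integrable lborel {0..2*R} w1"
    unfolding w1_def using set_integrable_ln_abs_diff[of 0 "2 * R" 0]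
    by (intro set_integrable_mult_right set_integral_add const) simp
  then have w2_int: "set_integrable lborel {0..2*R} w2"
    unfolding w2_def by (intro set_integral_add const set_integrable_abs)
  have far: "laplacian y = 0" if "norm (y - x) > 2 * R" for y
    using laplacian_far[OF _ that] x by simp
  have fibre: "integrable lborel (\<lambda>t. \<Phi> (y, t))"
      "(\<integral>t. \<Phi> (y, t) \<partial>lborel) = laplacian y * w1 (norm (y - x))"
      "(\<integral>t. norm (\<Phi> (y, t)) \<partial>lborel) \<le> norm (laplacian y * w2 (norm (y - x)))" if "y \<noteq> x" for y
  proof -
    have "integrable lborel (\<lambda>t. \<Phi> (y, t)) \<and>
      (\<integral>t. \<Phi> (y, t) \<partial>lborel) = laplacian y * w1 (norm (y - x)) \<and>
      (\<integral>t. norm (\<Phi> (y, t)) \<partial>lborel) \<le> norm (laplacian y * w2 (norm (y - x)))"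
    proof (cases "norm y < R")
      case False
      then have "laplacian y = 0" by (intro vanish_outside_disk(4)) simp
      then show ?thesis by (simp add: \<Phi>_def)
    next
      case True
      note circle = ln_distance_difference_circle_mean[OF x True that, folded K_def Q_def]
      have \<Phi>: "\<Phi> (y, t) = laplacian y * (indicator {0..2*pi} t *\<^sub>R K y t)" for t
        by (simp add: \<Phi>_def)
      have n\<Phi>: "norm (\<Phi> (y, t)) = \<bar>laplacian y\<bar> * (indicator {0..2*pi} t *\<^sub>R \<bar>K y t\<bar>)" for t
        by (simp add: \<Phi>_def abs_mult)
      have "integrable lborel (\<lambda>t. \<Phi> (y, t))"
        unfolding \<Phi> using circle(1)[unfolded set_integrable_def] by (rule integrable_mult_right)
      moreover have "(\<integral>t. \<Phi> (y, t) \<partial>lborel) = laplacian y * w1 (norm (y - x))"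
        unfolding \<Phi> integral_mult_right_zero set_lebesgue_integral_def[symmetric] circle(2) by (simp add: w1_def)
      moreover have "(\<integral>t. norm (\<Phi> (y, t)) \<partial>lborel) \<le> norm (laplacian y * w2 (norm (y - x)))"
      proof -
        have "(\<integral>t. norm (\<Phi> (y, t)) \<partial>lborel) = \<bar>laplacian y\<bar> * (LBINT t:{0..2*pi}. \<bar>K y t\<bar>)"
          unfolding n\<Phi> integral_mult_right_zero set_lebesgue_integral_def[symmetric] ..
        also have "\<dots> \<le> \<bar>laplacian y\<bar> * w2 (norm (y - x))"
          using circle(3) by (intro mult_left_mono) (simp_all add: w1_def w2_def abs_mult)
        also have "\<dots> \<le> norm (laplacian y * w2 (norm (y - x)))"
          by (simp add: abs_mult mult_left_mono)
        finally show ?thesis .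
      qed
      ultimately show ?thesis by blast
    qed
    then show "integrable lborel (\<lambda>t. \<Phi> (y, t))"
      "(\<integral>t. \<Phi> (y, t) \<partial>lborel) = laplacian y * w1 (norm (y - x))"
      "(\<integral>t. norm (\<Phi> (y, t)) \<partial>lborel) \<le> norm (laplacian y * w2 (norm (y - x)))" by blast+
  qed
  have ae: "AE y in lborel. y \<noteq> x"
    by (rule AE_lborel_singleton)
  have \<Phi>_int: "integrable (lborel \<Otimes>\<^sub>M lborel) \<Phi>"
  proof (rule lborel_pair.Fubini_integrable)
    show "AE y in lborel. integrable lborel (\<lambda>t. \<Phi> (y, t))"
      using ae by eventually_elim (rule fibre(1))
    show "integrable lborel (\<lambda>y. \<integral>t. norm (\<Phi> (y, t)) \<partial>lborel)"
    proof (rule Bochner_Integration.integrable_bound)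
      show "integrable lborel (\<lambda>y. laplacian y * w2 (norm (y - x)))"
        by (rule integrable_radial_weight[OF continuous_laplacian far w_meas(2) w2_int])
      show "AE y in lborel. norm (\<integral>t. norm (\<Phi> (y, t)) \<partial>lborel) \<le> norm (laplacian y * w2 (norm (y - x)))"
        using ae by eventually_elim (use fibre(3) in simp)
    qed measurable
  qed measurable
  have \<Phi>_int': "integrable (lborel \<Otimes>\<^sub>M lborel) (case_prod (\<lambda>y t. \<Phi> (y, t)))"
    using \<Phi>_int by simp
  have outer: "(\<integral>y. \<Phi> (y, t) \<partial>lborel) = indicator {0..2*pi} t *\<^sub>R log_potential x (R *\<^sub>R unit_vec t)" for t
    by (simp add: \<Phi>_def log_potential_def K_def)
  show "set_integrable lborel {0..2*pi} (\<lambda>t. log_potential x (R *\<^sub>R unit_vec t))"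
    using lborel_pair.integrable_snd[OF \<Phi>_int'] unfolding set_integrable_def outer .
  have "(LBINT t:{0..2*pi}. log_potential x (R *\<^sub>R unit_vec t)) = (\<integral>t. (\<integral>y. \<Phi> (y, t) \<partial>lborel) \<partial>lborel)"
    unfolding set_lebesgue_integral_def outer ..
  also have "\<dots> = (\<integral>y. (\<integral>t. \<Phi> (y, t) \<partial>lborel) \<partial>lborel)"
    by (rule lborel_pair.Fubini_integral[OF \<Phi>_int'])
  also have "\<dots> = (\<integral>y. laplacian y * w1 (norm (y - x)) \<partial>lborel)"
  proof (rule integral_cong_AE)
    show "AE y in lborel. (\<integral>t. \<Phi> (y, t) \<partial>lborel) = laplacian y * w1 (norm (y - x))"
      using ae by eventually_elim (rule fibre(2))
  qed measurable
  also have "\<dots> = 2 * pi * (LBINT r:{0..2*R}. r * circular_mean laplacian x r * w1 r)"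
    by (rule integral_radial_weight[OF continuous_laplacian far w_meas(1) w1_int])
  also have "(LBINT r:{0..2*R}. r * circular_mean laplacian x r * w1 r)
      = (LBINT r:{0..2*R}. (2 * pi) * (r * circular_mean laplacian x r * (ln R + ln \<bar>r\<bar>)))"
    unfolding w1_def by (simp only: mult_ac)
  also have "\<dots> = (2 * pi) * f x"
    unfolding set_integral_mult_right using potential_recovers_f[of x "ln R"] x by simp
  finally show "(LBINT t:{0..2*pi}. log_potential x (R *\<^sub>R unit_vec t)) = 4 * pi\<^sup>2 * f x"
    by (simp add: power2_eq_square)
qed

text \<open>
  Transfers the mean over the angle to the arc length measure for any function that agrees with the
  potential on the circle.
\<close>

lemma log_potential_arc_length_integral:
  assumes x: "norm x < R" and g: "\<And>p. norm p = R \<Longrightarrow> g p = 1 / (2 * pi) * log_potential x p"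
  shows "integrable (arc_length_measure R) g"
    and "f x = 1 / (2 * pi * R) * (\<integral>p. g p \<partial>(arc_length_measure R))"
proof -
  let ?h = "\<lambda>p. 1 / (2 * pi) * log_potential x p"
  have space: "space (arc_length_measure R) = sphere 0 R"
    by (simp add: arc_length_measure_def space_restrict_space)
  have eq: "g p = ?h p" if "p \<in> space (arc_length_measure R)" for p
    using that g by (simp add: space)
  have h: "?h \<in> borel_measurable (restrict_space borel (sphere 0 R))"
    by (rule measurable_restrict_space1) measurable
  have "set_integrable lborel {0..2*pi} (\<lambda>t. ?h (R *\<^sub>R unit_vec t))"
    by (intro set_integrable_mult_right log_potential_circle_mean(1) x)
  then have "integrable (arc_length_measure R) ?h"
    using integrable_arc_length_measure[OF R_pos h] by simp
  moreover have "integrable (arc_length_measure R) g \<longleftrightarrow> integrable (arc_length_measure R) ?h"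
    by (rule Bochner_Integration.integrable_cong[OF refl]) (rule eq)
  ultimately show "integrable (arc_length_measure R) g"
    by blast
  have "(\<integral>p. g p \<partial>(arc_length_measure R)) = (\<integral>p. ?h p \<partial>(arc_length_measure R))"
    by (rule Bochner_Integration.integral_cong[OF refl eq])
  also have "\<dots> = R * (1 / (2 * pi) * (4 * pi\<^sup>2 * f x))"
    unfolding integral_arc_length_measure[OF R_pos h] set_integral_mult_right log_potential_circle_mean(2)[OF x] ..
  finally show "f x = 1 / (2 * pi * R) * (\<integral>p. g p \<partial>(arc_length_measure R))"
    using R_pos by (simp add: power2_eq_square)
qed

end

section \<open>The inversion formulas\<close>

theorem corollary1:
  fixes R0 :: real and f :: "real^2 \<Rightarrow> real" and D S :: "(real^2) set" and x :: "real^2"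
  defines "D \<equiv> ball 0 R0"
    and "S \<equiv> frontier D"
  assumes "R0 > 0"
    and "C_infinity f"
    and "support f \<subseteq> closure D"
    and "x \<in> D"
  shows "(\<forall>p\<in>S. pv_integrable (-2 * R0) (2 * R0) (norm (x - p))
            (\<lambda>r. r * dr_circular_mean f p r / (norm (x - p) - r))) \<and>
         integrable (arc_length_measure R0)
           (\<lambda>p. pv_integral (-2 * R0) (2 * R0) (norm (x - p))
                  (\<lambda>r. r * dr_circular_mean f p r / (norm (x - p) - r))) \<and>
         f x = 1 / (2 * pi * R0) *
           (\<integral>p. pv_integral (-2 * R0) (2 * R0) (norm (x - p))
                  (\<lambda>r. r * dr_circular_mean f p r / (norm (x - p) - r))
              \<partial>(arc_length_measure R0)) \<and>
         (\<forall>p\<in>S. pv_integrable (-2 * R0) (2 * R0) (norm (x - p))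
            (\<lambda>r. dr_circular_mean f p r / (norm (x - p) - r))) \<and>
         integrable (arc_length_measure R0)
           (\<lambda>p. norm (x - p) * pv_integral (-2 * R0) (2 * R0) (norm (x - p))
                  (\<lambda>r. dr_circular_mean f p r / (norm (x - p) - r))) \<and>
         f x = 1 / (2 * pi * R0) *
           (\<integral>p. norm (x - p) * pv_integral (-2 * R0) (2 * R0) (norm (x - p))
                  (\<lambda>r. dr_circular_mean f p r / (norm (x - p) - r))
              \<partial>(arc_length_measure R0))"
proof -
  obtain fx fy fxx fxy fyx fyy where "C2_plane f fx fy fxx fxy fyx fyy"
    using C_infinity_imp_C2_plane[OF \<open>C_infinity f\<close>] by (elim exE)
  then interpret C2_plane f fx fy fxx fxy fyx fyy .
  have "f y = 0" if "norm y > R0" for y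
  proof (rule ccontr)
    assume "f y \<noteq> 0"
    then have "y \<in> support f"
      using closure_subset[of "{y. f y \<noteq> 0}"] by (auto simp: support_def)
    then show False
      using \<open>support f \<subseteq> closure D\<close> \<open>R0 > 0\<close> that by (auto simp: D_def)
  qed
  then interpret C2_disk f fx fy fxx fxy fyx fyy R0
    using \<open>R0 > 0\<close> by unfold_locales
  have x: "norm x < R0"
    using \<open>x \<in> D\<close> by (simp add: D_def)
  have S: "norm p = R0" if "p \<in> S" for p
    using that \<open>R0 > 0\<close> by (simp add: S_def D_def)
  show ?thesis
    by (intro conjI ballI pv_integrable_weighted_kernel[OF x S] pv_integrable_plain_kernel[OF x S] log_potential_arc_length_integral[OF x] pv_integral_weighted_kernel[OF x] pv_integral_plain_kernel[OF x])
qed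

end
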